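(* In addition to the hypotheses of Theorem 2 (in particular $f$ uniformly $K$-Lipschitz in its second variable on $\mathbb{R}_+$), suppose that $u_T$, $m_0$ and $f$ are such that $\phi^{n+\frac12},\psi^n\in C^{1,2}([0,T]\times[0,1])$ for all $n\in\mathbb{N}$ and $\phi,\psi\in C^{1,2}([0,T]\times[0,1])$. Then $$\lim_{n\to\infty}\limsup_{\Delta t,\Delta x\to0}\|\widehat\phi^{n+\frac12}-\tilde\phi\|=0,\qquad \lim_{n\to\infty}\limsup_{\Delta t,\Delta x\to0}\|\widehat\psi^{n+1}-\tilde\psi\|=0,$$ where $\tilde\phi_{i,j}=\phi(t_i,x_j)$, $\tilde\psi_{i,j}=\psi(t_i,x_j)$ and $\Delta t=T/I\to0$, $\Delta x=1/J\to0$.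
   Context: Setting: $\Omega=(0,1)$, $T>0$, $\sigma>0$; $u_T,m_0:[0,1]\to\mathbb{R}$ bounded, $m_0\ge0$. $f:[0,1]\times\mathbb{R}\to\mathbb{R}$ is continuous and nonincreasing in its second variable, bounded, $f\le0$, and $|f(x,\xi_2)-f(x,\xi_1)|\le K|\xi_2-\xi_1|$ for $\xi_1,\xi_2\ge0$. Continuous sequences: $\psi^0=0$; $\phi^{n+\frac12}$ solves $\partial_t\phi+\frac{\sigma^2}{2}\partial_{xx}\phi=-\frac{1}{\sigma^2}f(x,\phi\psi^n)\phi$ on $(0,T)\times(0,1)$, Neumann conditions, $\phi(T)=\exp(u_T/\sigma^2)$; $\psi^{n+1}$ solves $\partial_t\psi-\frac{\sigma^2}{2}\partial_{xx}\psi=\frac{1}{\sigma^2}f(x,\phi^{n+\frac12}\psi)\psi$, Neumann conditions, $\psi(0)=m_0/\phi^{n+\frac12}(0)$. $(\phi^{n+\frac12})_n$ decreases and $(\psi^n)_n$ increases, pointwise, to limits $\phi$, $\psi$, which form a (weak) solution of the coupled system $\partial_t\phi+\frac{\sigma^2}{2}\partial_{xx}\phi=-\frac{1}{\sigma^2}f(x,\phi\psi)\phi$, $\partial_t\psi-\frac{\sigma^2}{2}\partial_{xx}\psi=\frac{1}{\sigma^2}f(x,\phi\psi)\psi$ with the same boundary, terminal and initial conditions. Discrete setting: for positive integers $I,J$, $\Delta t=T/I$, $\Delta x=1/J$, $t_i=i\Delta t$, $x_j=j\Delta x$; $\mathcal{M}$ the set of real matrices indexed $0\le i\le I$, $0\le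 j\le J$, with conventions $a_{i,-1}=a_{i,0}$, $a_{i,J+1}=a_{i,J}$. $\widehat\psi^0=0$; $\widehat\phi^{n+\frac12}\in\mathcal{M}$ is the unique solution of $\frac{\widehat\phi_{i+1,j}-\widehat\phi_{i,j}}{\Delta t}+\frac{\sigma^2}{2}\frac{\widehat\phi_{i,j+1}-2\widehat\phi_{i,j}+\widehat\phi_{i,j-1}}{(\Delta x)^2}=-\frac{1}{\sigma^2}f(x_j,\widehat\phi_{i,j}\widehat\psi^n_{i,j})\widehat\phi_{i,j}$ ($0\le i\le I-1$), $\widehat\phi_{I,j}=\exp(u_T(x_j)/\sigma^2)$; $\widehat\psi^{n+1}\in\mathcal{M}$ is the unique solution of $\frac{\widehat\psi_{i+1,j}-\widehat\psi_{i,j}}{\Delta t}-\frac{\sigma^2}{2}\frac{\widehat\psi_{i+1,j+1}-2\widehat\psi_{i+1,j}+\widehat\psi_{i+1,j-1}}{(\Delta x)^2}=\frac{1}{\sigma^2}f(x_j,\widehat\phi^{n+\frac12}_{i+1,j}\widehat\psi_{i+1,j})\widehat\psi_{i+1,j}$, $\widehat\psi_{0,j}=m_0(x_j)/\widehat\phi^{n+\frac12}_{0,j}$. Norm: $\|m\|^2=\sup_{0\le i\le I}\frac{1}{J+1}\sum_{j=0}^Jm_{i,j}^2$. *)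

theory Defs
  imports "HOL-Analysis.Analysis"
begin

definition C12_with :: "real \<Rightarrow> (real \<Rightarrow> real \<Rightarrow> real) \<Rightarrow> (real \<Rightarrow> real \<Rightarrow> real)
    \<Rightarrow> (real \<Rightarrow> real \<Rightarrow> real) \<Rightarrow> (real \<Rightarrow> real \<Rightarrow> real) \<Rightarrow> bool" where
  "C12_with T u ut ux uxx \<longleftrightarrow>
     continuous_on ({0..T} \<times> {0..1}) (\<lambda>(t,x). u t x) \<and>
     continuous_on ({0..T} \<times> {0..1}) (\<lambda>(t,x). ut t x) \<and>
     continuous_on ({0..T} \<times> {0..1}) (\<lambda>(t,x). ux t x) \<and>
     continuous_on ({0..T} \<times> {0..1}) (\<lambda>(t,x). uxx t x) \<and>
     (\<forall>t\<in>{0..T}. \<forall>x\<in>{0..1}.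
        ((\<lambda>s. u s x) has_real_derivative ut t x) (at t within {0..T}) \<and>
        ((\<lambda>y. u t y) has_real_derivative ux t x) (at x within {0..1}) \<and>
        ((\<lambda>y. ux t y) has_real_derivative uxx t x) (at x within {0..1}))"

definition C12 :: "real \<Rightarrow> (real \<Rightarrow> real \<Rightarrow> real) \<Rightarrow> bool" where
  "C12 T u \<longleftrightarrow> (\<exists>ut ux uxx. C12_with T u ut ux uxx)"

definition bwd_solution :: "real \<Rightarrow> real \<Rightarrow> (real \<Rightarrow> real \<Rightarrow> real) \<Rightarrow> (real \<Rightarrow> real \<Rightarrow> real)
    \<Rightarrow> (real \<Rightarrow> real) \<Rightarrow> (real \<Rightarrow> real \<Rightarrow> real) \<Rightarrow> bool" where
  "bwd_solution T \<sigma> f psi uT phi \<longleftrightarrow>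
     (\<exists>pt px pxx. C12_with T phi pt px pxx \<and>
        (\<forall>t\<in>{0<..<T}. \<forall>x\<in>{0<..<1}.
           pt t x + \<sigma>\<^sup>2 / 2 * pxx t x = - (1 / \<sigma>\<^sup>2) * f x (phi t x * psi t x) * phi t x) \<and>
        (\<forall>t\<in>{0..T}. px t 0 = 0 \<and> px t 1 = 0) \<and>
        (\<forall>x\<in>{0..1}. phi T x = exp (uT x / \<sigma>\<^sup>2)))"

definition fwd_solution :: "real \<Rightarrow> real \<Rightarrow> (real \<Rightarrow> real \<Rightarrow> real) \<Rightarrow> (real \<Rightarrow> real \<Rightarrow> real)
    \<Rightarrow> (real \<Rightarrow> real) \<Rightarrow> (real \<Rightarrow> real \<Rightarrow> real) \<Rightarrow> bool" where
  "fwd_solution T \<sigma> f phi m0 psi \<longleftrightarrow>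
     (\<exists>pt px pxx. C12_with T psi pt px pxx \<and>
        (\<forall>t\<in>{0<..<T}. \<forall>x\<in>{0<..<1}.
           pt t x - \<sigma>\<^sup>2 / 2 * pxx t x = (1 / \<sigma>\<^sup>2) * f x (phi t x * psi t x) * psi t x) \<and>
        (\<forall>t\<in>{0..T}. px t 0 = 0 \<and> px t 1 = 0) \<and>
        (\<forall>x\<in>{0..1}. psi 0 x = m0 x / phi 0 x))"

(* Matrices in M: functions nat => nat => real, meaningful for i <= I, j <= J.
   Neighbour conventions a_{i,-1} = a_{i,0} (nat subtraction 0 - 1 = 0) and
   a_{i,J+1} = a_{i,J} (via min (Suc j) J). dt = T/I, dx = 1/J, x_j = j/J. *)
definition disc_phi_scheme :: "real \<Rightarrow> real \<Rightarrow> (real \<Rightarrow> real \<Rightarrow> real) \<Rightarrow> (real \<Rightarrow> real)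
    \<Rightarrow> nat \<Rightarrow> nat \<Rightarrow> (nat \<Rightarrow> nat \<Rightarrow> real) \<Rightarrow> (nat \<Rightarrow> nat \<Rightarrow> real) \<Rightarrow> bool" where
  "disc_phi_scheme T \<sigma> f uT I J ps ph \<longleftrightarrow>
     (\<forall>i<I. \<forall>j\<le>J.
        (ph (Suc i) j - ph i j) / (T / real I)
        + \<sigma>\<^sup>2 / 2 * (ph i (min (Suc j) J) - 2 * ph i j + ph i (j - 1)) / (1 / real J)\<^sup>2
        = - (1 / \<sigma>\<^sup>2) * f (real j / real J) (ph i j * ps i j) * ph i j) \<and>
     (\<forall>j\<le>J. ph I j = exp (uT (real j / real J) / \<sigma>\<^sup>2))"

definition disc_psi_scheme :: "real \<Rightarrow> real \<Rightarrow> (real \<Rightarrow> real \<Rightarrow> real) \<Rightarrow> (real \<Rightarrow> real)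
    \<Rightarrow> nat \<Rightarrow> nat \<Rightarrow> (nat \<Rightarrow> nat \<Rightarrow> real) \<Rightarrow> (nat \<Rightarrow> nat \<Rightarrow> real) \<Rightarrow> bool" where
  "disc_psi_scheme T \<sigma> f m0 I J ph ps \<longleftrightarrow>
     (\<forall>i<I. \<forall>j\<le>J.
        (ps (Suc i) j - ps i j) / (T / real I)
        - \<sigma>\<^sup>2 / 2 * (ps (Suc i) (min (Suc j) J) - 2 * ps (Suc i) j + ps (Suc i) (j - 1)) / (1 / real J)\<^sup>2
        = (1 / \<sigma>\<^sup>2) * f (real j / real J) (ph (Suc i) j * ps (Suc i) j) * ps (Suc i) j) \<and>
     (\<forall>j\<le>J. ps 0 j = m0 (real j / real J) / ph 0 j)"

definition disc_norm :: "nat \<Rightarrow> nat \<Rightarrow> (nat \<Rightarrow> nat \<Rightarrow> real) \<Rightarrow> real" where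
  "disc_norm I J m = sqrt (MAX i\<in>{..I}. (1 / (real J + 1)) * (\<Sum>j\<le>J. (m i j)\<^sup>2))"

end

theory Submission
  imports Defs
begin

text \<open>
  For fixed \<open>n\<close>, each scheme is implicit, so testing the equation for the error against the positive
  part of the error gives \<open>L\<^sup>2\<close> stability: the discrete Neumann Laplacian is negative semidefinite, and
  since \<open>f\<close> is nonpositive and nonincreasing the reaction term has the good sign, so no Gronwall
  argument is needed. The truncation error tends to 0 uniformly away from the boundary nodes; at
  \<open>j = 0\<close> and \<open>j = J\<close> it is only bounded, but two nodes out of \<open>J + 1\<close> do not matter in \<open>L\<^sup>2\<close>.
  The backward equation becomes a forward one under time reversal, so induction on \<open>n\<close> gives
  convergence of each iterate to its continuous counterpart. The maximum principle makes the
  continuous iterates monotone in \<open>n\<close>, and Dini's theorem makes their convergence uniform.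
\<close>

subsection \<open>Maximum principle with Neumann conditions\<close>

text \<open>Testing with the positive part of the error, and with that of its negative separately,
  lets one stability estimate serve two purposes. With zero residual it is a discrete comparison
  principle, which yields nonnegativity and a positive lower bound for the discrete
  \<open>phi\<close>; with the truncation error as residual it yields convergence. The lower bound
  is what controls the coupling through the initial datum \<open>m0 / phi\<close>, so it is needed
  for the continuous and the discrete iterates, with a constant independent of the mesh and of the
  iterate. The error inherited from the preceding half-step is known to be small only in the
  normalised discrete L2 norm. It is therefore put into the residual, by the Lipschitz bound taken
  at the value of the exact solution: only the exact solution has to be bounded above, never the
  discrete one.\<close>

lemma le_zero_from_interior:
  fixes g d :: "real \<times> real \<Rightarrow> real"
  assumes T: "T > 0"
    and g: "continuous_on ({0..T} \<times> {0..1}) g"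
    and d: "continuous_on ({0..T} \<times> {0..1}) d"
    and le: "\<And>t x. t \<in> {0<..<T} \<Longrightarrow> x \<in> {0<..<1} \<Longrightarrow> d (t,x) > 0 \<Longrightarrow> g (t,x) \<le> 0"
    and p: "p \<in> {0..T} \<times> {0..1}" "d p > 0"
  shows "g p \<le> 0"
proof -
  have "p \<in> closure ({0<..<T} \<times> {0<..<1::real})"
    using T p by (simp add: closure_Times)
  then obtain s where s: "\<And>n. s n \<in> {0<..<T} \<times> {0<..<1::real}" "s \<longlonglongrightarrow> p"
    by (auto simp: closure_sequential)
  have s': "s n \<in> {0..T} \<times> {0..1}" for n
    using s(1)[of n] by (auto simp: mem_Times_iff intro: less_imp_le)
  have cg: "(\<lambda>n. g (s n)) \<longlonglongrightarrow> g p" and cd: "(\<lambda>n. d (s n)) \<longlonglongrightarrow> d p"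
    using continuous_on_tendsto_compose[OF g s(2) p(1)] continuous_on_tendsto_compose[OF d s(2) p(1)] s'
    by auto
  \<comment> \<open>Positivity of \<open>d\<close> is an open condition, so it passes from
    \<open>p\<close> to the interior points approaching \<open>p\<close>; this allows the premise
    \<open>le\<close> to be restricted to the set where \<open>d\<close> is positive.\<close>
  have "eventually (\<lambda>n. d (s n) > 0) sequentially"
    using order_tendstoD(1)[OF cd p(2)] .
  then have "eventually (\<lambda>n. g (s n) \<le> 0) sequentially"
  proof (rule eventually_mono)
    fix n assume "d (s n) > 0"
    then show "g (s n) \<le> 0"
      using le[of "fst (s n)" "snd (s n)"] s(1)[of n] by (auto simp: mem_Times_iff)
  qed
  then show ?thesis
    by (rule tendsto_upperbound[OF cg]) simp
qed

text \<open>The Neumann condition makes the end points behave like interior points: at every maximum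
  the first derivative vanishes, so a positive second derivative would let \<open>w\<close> rise on
  some side that stays inside the interval.\<close>

lemma Neumann_max_second_deriv_le:
  fixes w wx wxx :: "real \<Rightarrow> real"
  assumes d1: "\<And>y. y \<in> {0..1} \<Longrightarrow> (w has_real_derivative wx y) (at y within {0..1})"
    and d2: "\<And>y. y \<in> {0..1} \<Longrightarrow> (wx has_real_derivative wxx y) (at y within {0..1})"
    and bc: "wx 0 = 0" "wx 1 = 0"
    and x: "x \<in> {0..1}" and mx: "\<And>y. y \<in> {0..1} \<Longrightarrow> w y \<le> w x"
  shows "wxx x \<le> 0"
proof (rule ccontr)
  assume neg: "\<not> wxx x \<le> 0"
  have wx0: "wx x = 0"
  proof (rule ccontr)
    assume ne: "wx x \<noteq> 0"
    then have x01: "0 < x" "x < 1" using bc x by (auto simp: less_le)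
    show False
    proof (cases "wx x > 0")
      case True
      then obtain e where e: "e > 0" "\<And>h. h > 0 \<Longrightarrow> x + h \<in> {0..1} \<Longrightarrow> h < e \<Longrightarrow> w x < w (x + h)"
        using has_real_derivative_pos_inc_right[OF d1[OF x]] by blast
      define h where "h = min (e/2) (1 - x)"
      have "h > 0" "h < e" "x + h \<in> {0..1}" using e(1) x01 by (auto simp: h_def min_def)
      then show False using e(2)[of h] mx[of "x + h"] by force
    next
      case False
      then have "wx x < 0" using ne by simp
      then obtain e where e: "e > 0" "\<And>h. h > 0 \<Longrightarrow> x - h \<in> {0..1} \<Longrightarrow> h < e \<Longrightarrow> w x < w (x - h)"
        using has_real_derivative_neg_dec_left[OF d1[OF x]] by blast
      define h where "h = min (e/2) x"
      have "h > 0" "h < e" "x - h \<in> {0..1}" using e(1) x01 by (auto simp: h_def min_def)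
      then show False using e(2)[of h] mx[of "x - h"] by force
    qed
  qed
  show False
  \<comment> \<open>One side suffices: to the right whenever there is room, which includes
    \<open>x = 0\<close>, and to the left only at \<open>x = 1\<close>.\<close>
  proof (cases "x < 1")
    case True
    obtain e where e: "e > 0" "\<And>h. h > 0 \<Longrightarrow> x + h \<in> {0..1} \<Longrightarrow> h < e \<Longrightarrow> wx x < wx (x + h)"
      using has_real_derivative_pos_inc_right[OF d2[OF x]] neg by (metis not_le)
    define h where "h = min (e/2) (1 - x)"
    have h: "h > 0" "h < e" "x + h \<le> 1" using e(1) True by (auto simp: h_def min_def)
    have "\<exists>z\<in>{x<..<x+h}. w (x + h) - w x = wx z * (x + h - x)"
    proof (rule mvt_simple)
      fix y assume "x \<le> y" "y \<le> x + h"
      then show "(w has_derivative (*) (wx y)) (at y within {x..x + h})"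
        using h x d1[of y] has_field_derivative_subset[of w "wx y" y "{0..1}" "{x..x+h}"]
        by (auto simp: has_field_derivative_def)
    qed (use h in auto)
    then obtain z where z: "x < z" "z < x + h" "w (x + h) - w x = wx z * h" by auto
    have "wx z > 0" using e(2)[of "z - x"] z h x wx0 by auto
    then have "w (x + h) > w x" using z h by (smt (verit) mult_pos_pos)
    then show False using mx[of "x + h"] h x by auto
  next
    case False
    then have x1: "x = 1" using x by auto
    obtain e where e: "e > 0" "\<And>h. h > 0 \<Longrightarrow> x - h \<in> {0..1} \<Longrightarrow> h < e \<Longrightarrow> wx (x - h) < wx x"
      using has_real_derivative_pos_inc_left[OF d2[OF x]] neg by (metis not_le)
    define h where "h = min (e/2) 1"
    have h: "h > 0" "h < e" "h \<le> 1" using e(1) by (auto simp: h_def min_def)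
    have "\<exists>z\<in>{x-h<..<x}. w x - w (x - h) = wx z * (x - (x - h))"
    proof (rule mvt_simple)
      fix y assume "x - h \<le> y" "y \<le> x"
      then show "(w has_derivative (*) (wx y)) (at y within {x - h..x})"
        using h x x1 d1[of y] has_field_derivative_subset[of w "wx y" y "{0..1}" "{x-h..x}"]
        by (auto simp: has_field_derivative_def)
    qed (use h in auto)
    then obtain z where z: "x - h < z" "z < x" "w x - w (x - h) = wx z * h" by auto
    have "wx z < 0" using e(2)[of "x - z"] z h x wx0 x1 by auto
    then have "w (x - h) > w x" using z h by (smt (verit) mult_neg_pos)
    then show False using mx[of "x - h"] h x x1 by auto
  qed
qed

text \<open>Common form of both equations of the system, the backward one after time reversal. The
  right-hand side is an arbitrary function of \<open>(t, x)\<close>, into which a source depending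
  on \<open>u\<close> itself can be substituted; initial data are kept apart.\<close>

definition parabolic :: "real \<Rightarrow> real \<Rightarrow> (real \<Rightarrow> real \<Rightarrow> real) \<Rightarrow> (real \<Rightarrow> real \<Rightarrow> real) \<Rightarrow> bool" where
  "parabolic T a u h \<longleftrightarrow>
     (\<exists>ut ux uxx. C12_with T u ut ux uxx \<and>
        (\<forall>t\<in>{0<..<T}. \<forall>x\<in>{0<..<1}. ut t x - a * uxx t x = h t x) \<and>
        (\<forall>t\<in>{0..T}. ux t 0 = 0 \<and> ux t 1 = 0))"

text \<open>At a positive maximum of \<open>u - v - e * t\<close> the time derivative of
  \<open>u - v\<close> is at least \<open>e\<close> and its second space derivative is nonpositive,
  which contradicts the equations. The sources are compared only where \<open>u\<close> exceeds
  \<open>v\<close>, so sources that depend on the unknown with a favourable monotonicity are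
  covered.\<close>

lemma parabolic_comparison:
  assumes T: "T > 0" and a: "a \<ge> 0"
    and u: "parabolic T a u h" and v: "parabolic T a v k"
    and rhs: "\<And>t x. t \<in> {0<..<T} \<Longrightarrow> x \<in> {0<..<1} \<Longrightarrow> u t x > v t x \<Longrightarrow> h t x \<le> k t x"
    and init: "\<And>x. x \<in> {0..1} \<Longrightarrow> u 0 x \<le> v 0 x"
    and tx: "t \<in> {0..T}" "x \<in> {0..1}"
  shows "u t x \<le> v t x"
proof (rule ccontr)
  assume "\<not> u t x \<le> v t x"
  then have pos: "u t x - v t x > 0" by simp
  obtain ut ux uxx where U: "C12_with T u ut ux uxx"
      "\<And>t x. t\<in>{0<..<T} \<Longrightarrow> x\<in>{0<..<1} \<Longrightarrow> ut t x - a * uxx t x = h t x"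
      "\<And>t. t\<in>{0..T} \<Longrightarrow> ux t 0 = 0 \<and> ux t 1 = 0"
    using u unfolding parabolic_def by blast
  obtain vt vx vxx where V: "C12_with T v vt vx vxx"
      "\<And>t x. t\<in>{0<..<T} \<Longrightarrow> x\<in>{0<..<1} \<Longrightarrow> vt t x - a * vxx t x = k t x"
      "\<And>t. t\<in>{0..T} \<Longrightarrow> vx t 0 = 0 \<and> vx t 1 = 0"
    using v unfolding parabolic_def by blast
  note Ud = U(1)[unfolded C12_with_def] note Vd = V(1)[unfolded C12_with_def]
  \<comment> \<open>With this slope the penalty up to time \<open>T\<close> takes away at most half
    of the assumed gap, so the penalised function stays positive at \<open>(t, x)\<close>.\<close>
  define e where "e = (u t x - v t x) / (2 * T)"
  have e: "e > 0" using pos T by (simp add: e_def)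
  define w where "w = (\<lambda>(t,x). u t x - v t x - e * t)"
  let ?Q = "{0..T} \<times> {0..1::real}"
  have cw: "continuous_on ?Q w"
    unfolding w_def case_prod_unfold using Ud Vd
    by (intro continuous_intros) (auto simp: case_prod_unfold)
  have "\<exists>p\<in>?Q. \<forall>q\<in>?Q. w q \<le> w p"
    using cw tx by (intro continuous_attains_sup) (auto intro: compact_Times)
  then obtain t0 x0 where m: "t0 \<in> {0..T}" "x0 \<in> {0..1}"
      "\<And>s y. s \<in> {0..T} \<Longrightarrow> y \<in> {0..1} \<Longrightarrow> w (s,y) \<le> w (t0,x0)" by auto
  have "e * t \<le> e * T" using tx e by simp
  also have "\<dots> = (u t x - v t x) / 2" using T by (simp add: e_def)
  finally have "w (t,x) > 0" using pos by (simp add: w_def)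
  then have w0: "w (t0,x0) > 0" using m(3)[OF tx] by simp
  then have uv: "u t0 x0 - v t0 x0 > 0" using m(1) e by (simp add: w_def) (smt (verit) mult_nonneg_nonneg)
  \<comment> \<open>Time 0 is excluded by \<open>init\<close>. The sign of the time derivative is
    then read off from earlier times only, so \<open>t0 = T\<close> is covered.\<close>
  have t0: "t0 > 0"
    using w0 m init[OF m(2)] by (cases "t0 = 0") (auto simp: w_def)
  have dt: "((\<lambda>s. w (s,x0)) has_real_derivative (ut t0 x0 - vt t0 x0 - e)) (at t0 within {0..T})"
    unfolding w_def using Ud Vd m(1,2) by (auto intro!: derivative_eq_intros)
  have t1: "ut t0 x0 - vt t0 x0 - e \<ge> 0"
  proof (rule ccontr)
    assume "\<not> ?thesis"
    then obtain d where d: "d > 0" "\<And>h. h > 0 \<Longrightarrow> t0 - h \<in> {0..T} \<Longrightarrow> h < d \<Longrightarrow> w (t0,x0) < w (t0 - h,x0)"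
      using has_real_derivative_neg_dec_left[OF dt] by (metis not_le)
    define h where "h = min (d/2) t0"
    have "h > 0" "h < d" "t0 - h \<in> {0..T}" using d(1) t0 m(1) by (auto simp: h_def min_def)
    then show False using d(2)[of h] m(3)[of "t0 - h" x0] m(2) by force
  qed
  have x1: "uxx t0 x0 - vxx t0 x0 \<le> 0"
  proof (rule Neumann_max_second_deriv_le[where w = "\<lambda>y. w (t0,y)" and wx = "\<lambda>y. ux t0 y - vx t0 y"
          and wxx = "\<lambda>y. uxx t0 y - vxx t0 y"])
    fix y :: real assume y: "y \<in> {0..1}"
    show "((\<lambda>y. w (t0, y)) has_real_derivative ux t0 y - vx t0 y) (at y within {0..1})"
      unfolding w_def using Ud Vd m(1,2) y by (auto intro!: derivative_eq_intros)
    show "((\<lambda>y. ux t0 y - vx t0 y) has_real_derivative uxx t0 y - vxx t0 y) (at y within {0..1})"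
      using Ud Vd m(1,2) y by (auto intro!: derivative_eq_intros)
    show "w (t0, y) \<le> w (t0, x0)" using m(1) m(3) y by auto
  qed (use U(3) V(3) m in auto)
  \<comment> \<open>The maximum may lie on the lateral boundary or at the final time, where no
    equation is assumed. The inequality is carried over from the interior by continuity, within the
    set where \<open>u - v\<close> is positive.\<close>
  have "(\<lambda>(t,x). (ut t x - vt t x) - a * (uxx t x - vxx t x)) (t0,x0) \<le> 0"
  proof (rule le_zero_from_interior[OF T, where d = "\<lambda>(t,x). u t x - v t x"])
    show "continuous_on ?Q (\<lambda>(t,x). (ut t x - vt t x) - a * (uxx t x - vxx t x))"
      unfolding case_prod_unfold using Ud Vd
      by (intro continuous_intros) (auto simp: case_prod_unfold)
    show "continuous_on ?Q (\<lambda>(t,x). u t x - v t x)"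
      unfolding case_prod_unfold using Ud Vd
      by (intro continuous_intros) (auto simp: case_prod_unfold)
    fix t x :: real assume A: "t \<in> {0<..<T}" "x \<in> {0<..<1}" "(case (t, x) of (t, x) \<Rightarrow> u t x - v t x) > 0"
    have "h t x \<le> k t x" using rhs[of t x] A by simp
    then show "(case (t, x) of (t, x) \<Rightarrow> (ut t x - vt t x) - a * (uxx t x - vxx t x)) \<le> 0"
      using U(2)[OF A(1,2)] V(2)[OF A(1,2)] by (simp add: algebra_simps)
  qed (use m uv in auto)
  then show False using t1 x1 e a mult_nonneg_nonpos[OF a x1] by simp
qed

subsection \<open>Discrete energy estimate\<close>

definition disc_lap :: "nat \<Rightarrow> (nat \<Rightarrow> real) \<Rightarrow> nat \<Rightarrow> real" where
  "disc_lap J w j = w (min (Suc j) J) - 2 * w j + w (j - 1)"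

lemma sum_shift_up:
  fixes g :: "nat \<Rightarrow> real"
  shows "(\<Sum>j\<le>J. g (min (Suc j) J)) = (\<Sum>j\<le>J. g j) - g 0 + g J"
proof (cases J)
  case (Suc n)
  have "(\<Sum>j\<le>Suc n. g (min (Suc j) (Suc n))) = (\<Sum>j\<le>n. g (Suc j)) + g (Suc n)"
    by simp
  also have "(\<Sum>j\<le>n. g (Suc j)) = (\<Sum>j\<le>Suc n. g j) - g 0"
    by (simp only: sum.atMost_Suc_shift[of g n])
  finally show ?thesis using Suc by simp
qed simp

lemma sum_shift_down:
  fixes g :: "nat \<Rightarrow> real"
  shows "(\<Sum>j\<le>J. g (j - 1)) = (\<Sum>j\<le>J. g j) + g 0 - g J"
proof (cases J)
  case (Suc n)
  have "(\<Sum>j\<le>Suc n. g (j - 1)) = g 0 + (\<Sum>j\<le>n. g j)"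
    by (subst sum.atMost_Suc_shift) simp
  then show ?thesis using Suc by simp
qed simp

text \<open>The inequality \<open>2 * (x * y) \<le> x\<^sup>2 + y\<^sup>2\<close> bounds each term
  by half the second difference of the squares. The sum of these vanishes: each clamped shift
  repeats one end value and loses the other, and the two shifts do so at opposite ends.\<close>

lemma disc_lap_energy: "(\<Sum>j\<le>J. disc_lap J p j * p j) \<le> 0"
proof -
  have "(\<Sum>j\<le>J. disc_lap J p j * p j) \<le>
      (\<Sum>j\<le>J. ((p (min (Suc j) J))\<^sup>2 - 2 * (p j)\<^sup>2 + (p (j - 1))\<^sup>2) / 2)"
  proof (rule sum_mono)
    fix j
    have "2 * (x * y) \<le> x\<^sup>2 + y\<^sup>2" for x y :: real
      using sum_squares_bound[of x y] by simp
    from this[of "p (min (Suc j) J)" "p j"] this[of "p (j - 1)" "p j"]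
    show "disc_lap J p j * p j \<le> ((p (min (Suc j) J))\<^sup>2 - 2 * (p j)\<^sup>2 + (p (j - 1))\<^sup>2) / 2"
      by (simp add: disc_lap_def algebra_simps power2_eq_square)
  qed
  also have "\<dots> = ((\<Sum>j\<le>J. (p (min (Suc j) J))\<^sup>2) - 2 * (\<Sum>j\<le>J. (p j)\<^sup>2) + (\<Sum>j\<le>J. (p (j - 1))\<^sup>2)) / 2"
    by (simp add: sum_divide_distrib[symmetric] sum.distrib sum_subtractf sum_distrib_left)
  also have "\<dots> = 0"
    using sum_shift_up[of "\<lambda>j. (p j)\<^sup>2" J] sum_shift_down[of "\<lambda>j. (p j)\<^sup>2" J] by simp
  finally show ?thesis .
qed

text \<open>The step inequality is multiplied by the positive part of \<open>new\<close> and summed.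
  Nodes with \<open>new j \<le> 0\<close> contribute nothing, which is why \<open>step\<close> is
  asked only elsewhere; the Laplacian term is dropped by its sign, and Cauchy-Schwarz leaves a bound
  with growth factor 1.\<close>

lemma implicit_step_positive_part:
  fixes new old r :: "nat \<Rightarrow> real"
  assumes lam: "lam \<ge> 0"
    and step: "\<And>j. j \<le> J \<Longrightarrow> new j > 0 \<Longrightarrow> new j - lam * disc_lap J new j \<le> old j + r j"
  shows "L2_set (\<lambda>j. max 0 (new j)) {..J} \<le> L2_set (\<lambda>j. max 0 (old j)) {..J} + L2_set r {..J}"
proof -
  define p where "p j = max 0 (new j)" for j
  define q where "q j = max 0 (old j)" for j
  have "(\<Sum>j\<le>J. (p j)\<^sup>2) \<le> (\<Sum>j\<le>J. \<bar>p j\<bar> * \<bar>q j + r j\<bar> + lam * (disc_lap J p j * p j))"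
  proof (rule sum_mono)
    fix j assume j: "j \<in> {..J}"
    show "(p j)\<^sup>2 \<le> \<bar>p j\<bar> * \<bar>q j + r j\<bar> + lam * (disc_lap J p j * p j)"
    proof (cases "new j > 0")
      case True
      then have p: "p j = new j" "p j > 0" by (auto simp: p_def)
      \<comment> \<open>The centre values agree because \<open>new j\<close> is positive, while
        passing to positive parts can only raise the neighbours.\<close>
      have "disc_lap J new j \<le> disc_lap J p j"
        using p(1) by (simp add: disc_lap_def) (simp add: p_def)
      then have "lam * disc_lap J new j \<le> lam * disc_lap J p j"
        using lam by (rule mult_left_mono)
      moreover have "old j \<le> q j" by (simp add: q_def)
      ultimately have "p j \<le> \<bar>q j + r j\<bar> + lam * disc_lap J p j"
        using step[of j] True j p(1) by simp
      then have "p j * p j \<le> p j * (\<bar>q j + r j\<bar> + lam * disc_lap J p j)"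
        using p(2) by simp
      then show ?thesis using p(2) by (simp add: power2_eq_square algebra_simps)
    qed (simp add: p_def)
  qed
  also have "\<dots> = (\<Sum>j\<le>J. \<bar>p j\<bar> * \<bar>q j + r j\<bar>) + lam * (\<Sum>j\<le>J. disc_lap J p j * p j)"
    by (simp add: sum.distrib sum_distrib_left)
  also have "\<dots> \<le> (\<Sum>j\<le>J. \<bar>p j\<bar> * \<bar>q j + r j\<bar>)"
    using mult_nonneg_nonpos[OF lam disc_lap_energy] by simp
  also have "\<dots> \<le> L2_set p {..J} * L2_set (\<lambda>j. q j + r j) {..J}"
    by (rule L2_set_mult_ineq)
  also have "\<dots> \<le> L2_set p {..J} * (L2_set q {..J} + L2_set r {..J})"
    by (intro mult_left_mono L2_set_triangle_ineq L2_set_nonneg)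
  finally have le: "(L2_set p {..J})\<^sup>2 \<le> L2_set p {..J} * (L2_set q {..J} + L2_set r {..J})"
    by (simp add: L2_set_def sum_nonneg)
  have "L2_set p {..J} \<le> L2_set q {..J} + L2_set r {..J}"
  proof (cases "L2_set p {..J} = 0")
    case False
    then have "L2_set p {..J} > 0" using L2_set_nonneg[of p "{..J}"] by linarith
    then show ?thesis using le by (simp add: power2_eq_square)
  qed simp
  then show ?thesis by (simp add: p_def[abs_def] q_def[abs_def])
qed

text \<open>Implicit Euler: Laplacian and right-hand side are both taken at the new level
  \<open>Suc i\<close>, so the value of \<open>h\<close> at level 0 is never read.\<close>

definition disc_parabolic :: "real \<Rightarrow> real \<Rightarrow> nat \<Rightarrow> nat \<Rightarrow> (nat \<Rightarrow> nat \<Rightarrow> real) \<Rightarrow> (nat \<Rightarrow> nat \<Rightarrow> real) \<Rightarrow> bool" where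
  "disc_parabolic T a I J v h \<longleftrightarrow> (\<forall>i<I. \<forall>j\<le>J.
     (v (Suc i) j - v i j) / (T / real I) - a * disc_lap J (v (Suc i)) j / (1 / real J)\<^sup>2 = h (Suc i) j)"

text \<open>At most \<open>I\<close> steps, each adding \<open>T / I\<close> times a residual of
  norm at most \<open>R\<close>, give \<open>T * R\<close>. Since \<open>r\<close> bounds the
  difference of the sources from above, and only where \<open>v\<close> exceeds \<open>w\<close>, a
  reaction term of good sign can be discarded before the bound is applied.\<close>

lemma disc_parabolic_positive_part:
  assumes T: "T > 0" and I: "I \<ge> 1" and a: "a \<ge> 0"
    and v: "disc_parabolic T a I J v h" and w: "disc_parabolic T a I J w k"
    and rhs: "\<And>i j. i < I \<Longrightarrow> j \<le> J \<Longrightarrow> v (Suc i) j > w (Suc i) j \<Longrightarrow>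
                h (Suc i) j - k (Suc i) j \<le> r (Suc i) j"
    and R: "\<And>i. i < I \<Longrightarrow> L2_set (r (Suc i)) {..J} \<le> R" and i: "i \<le> I"
  shows "L2_set (\<lambda>j. max 0 (v i j - w i j)) {..J}
           \<le> L2_set (\<lambda>j. max 0 (v 0 j - w 0 j)) {..J} + T * R"
proof -
  define dt where "dt = T / real I"
  define lam where "lam = dt * a / (1 / real J)\<^sup>2"
  have dt: "dt > 0" using T I by (simp add: dt_def)
  have lam: "lam \<ge> 0" using dt a by (simp add: lam_def)
  define e where "e i j = v i j - w i j" for i j
  have R0: "R \<ge> 0" using order_trans[OF L2_set_nonneg R[of 0]] I by simp
  have "L2_set (\<lambda>j. max 0 (e i j)) {..J} \<le> L2_set (\<lambda>j. max 0 (e 0 j)) {..J} + real i * dt * R"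
    using i
  proof (induction i)
    case (Suc i)
    have "L2_set (\<lambda>j. max 0 (e (Suc i) j)) {..J}
        \<le> L2_set (\<lambda>j. max 0 (e i j)) {..J} + L2_set (\<lambda>j. dt * r (Suc i) j) {..J}"
    proof (rule implicit_step_positive_part[OF lam])
      fix j assume j: "j \<le> J" "e (Suc i) j > 0"
      have V: "(v (Suc i) j - v i j) / dt - a * disc_lap J (v (Suc i)) j / (1 / real J)\<^sup>2 = h (Suc i) j"
        using v Suc.prems j unfolding disc_parabolic_def dt_def by simp
      have W: "(w (Suc i) j - w i j) / dt - a * disc_lap J (w (Suc i)) j / (1 / real J)\<^sup>2 = k (Suc i) j"
        using w Suc.prems j unfolding disc_parabolic_def dt_def by simp
      have scale: "x - lam * L = dt * (x / dt - a * L / (1 / real J)\<^sup>2)" for x L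
        using dt by (simp add: lam_def right_diff_distrib)
      have V': "v (Suc i) j - v i j - lam * disc_lap J (v (Suc i)) j = dt * h (Suc i) j"
        unfolding V[symmetric] by (rule scale)
      have W': "w (Suc i) j - w i j - lam * disc_lap J (w (Suc i)) j = dt * k (Suc i) j"
        unfolding W[symmetric] by (rule scale)
      have lap: "disc_lap J (e (Suc i)) j = disc_lap J (v (Suc i)) j - disc_lap J (w (Suc i)) j"
        by (simp add: disc_lap_def e_def)
      have "dt * (h (Suc i) j - k (Suc i) j) \<le> dt * r (Suc i) j"
        using rhs[of i j] j Suc.prems dt by (simp add: e_def)
      then show "e (Suc i) j - lam * disc_lap J (e (Suc i)) j \<le> e i j + dt * r (Suc i) j"
        using V' W' unfolding lap by (simp add: e_def algebra_simps)
    qed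
    also have "L2_set (\<lambda>j. dt * r (Suc i) j) {..J} = dt * L2_set (r (Suc i)) {..J}"
      using dt by (simp add: L2_set_right_distrib)
    also have "\<dots> \<le> dt * R" using R[of i] Suc.prems dt by simp
    finally show ?case using Suc by (simp add: algebra_simps)
  qed simp
  also have "real i * dt * R \<le> T * R"
  proof (rule mult_right_mono[OF _ R0])
    have "real i * dt \<le> real I * dt" using i dt by simp
    then show "real i * dt \<le> T" using I by (simp add: dt_def)
  qed
  finally show ?thesis by (simp add: e_def)
qed

lemma disc_parabolic_comparison:
  assumes T: "T > 0" and I: "I \<ge> 1" and a: "a \<ge> 0"
    and v: "disc_parabolic T a I J v h" and w: "disc_parabolic T a I J w k"
    and rhs: "\<And>i j. i < I \<Longrightarrow> j \<le> J \<Longrightarrow> v (Suc i) j > w (Suc i) j \<Longrightarrow> h (Suc i) j \<le> k (Suc i) j"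
    and init: "\<And>j. j \<le> J \<Longrightarrow> v 0 j \<le> w 0 j" and ij: "i \<le> I" "j \<le> J"
  shows "v i j \<le> w i j"
proof -
  have "L2_set (\<lambda>j. max 0 (v i j - w i j)) {..J}
           \<le> L2_set (\<lambda>j. max 0 (v 0 j - w 0 j)) {..J} + T * 0"
    by (rule disc_parabolic_positive_part[OF T I a v w, where r = "\<lambda>_ _. 0"])
       (use rhs ij in \<open>auto simp: L2_set_0'\<close>)
  also have "L2_set (\<lambda>j. max 0 (v 0 j - w 0 j)) {..J} = 0"
    using init by (intro L2_set_0') auto
  finally have "L2_set (\<lambda>j. max 0 (v i j - w i j)) {..J} \<le> 0" by simp
  then have "L2_set (\<lambda>j. max 0 (v i j - w i j)) {..J} = 0"
    using L2_set_nonneg by (rule antisym)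
  then have "max 0 (v i j - w i j) = 0"
    unfolding L2_set_eq_0_iff[OF finite_atMost] using ij by blast
  then show ?thesis by simp
qed

subsection \<open>Consistency\<close>

lemma abs_diff_divide_pos:
  fixes d x y :: real
  assumes "d > 0"
  shows "\<bar>x - d * y\<bar> / d = \<bar>x / d - y\<bar>"
proof -
  have eq: "x / d - y = (x - d * y) / d" using assms by (simp add: diff_divide_distrib)
  show ?thesis by (simp only: eq abs_divide abs_of_pos[OF assms])
qed

text \<open>Only continuity of the second derivative is available, so the remainder is measured by
  the oscillation \<open>e\<close> of \<open>uxx\<close> between the two points. The mean value
  inequality is used twice, for \<open>ux\<close> and then for \<open>u\<close>, along the segment
  in either direction.\<close>

lemma second_order_taylor:
  fixes u ux uxx :: "real \<Rightarrow> real"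
  assumes d1: "\<And>y. y \<in> {0..1} \<Longrightarrow> (u has_real_derivative ux y) (at y within {0..1})"
    and d2: "\<And>y. y \<in> {0..1} \<Longrightarrow> (ux has_real_derivative uxx y) (at y within {0..1})"
    and xy: "x \<in> {0..1}" "y \<in> {0..1}"
    and e: "\<And>z. z \<in> {0..1} \<Longrightarrow> \<bar>z - x\<bar> \<le> \<bar>y - x\<bar> \<Longrightarrow> \<bar>uxx z - uxx x\<bar> \<le> e"
  shows "\<bar>u y - u x - (y - x) * ux x - (y - x)\<^sup>2 / 2 * uxx x\<bar> \<le> e * (y - x)\<^sup>2"
proof -
  define S where "S = closed_segment x y"
  have S: "z \<in> {0..1} \<and> \<bar>z - x\<bar> \<le> \<bar>y - x\<bar>" if "z \<in> S" for z
    using that xy by (auto simp: S_def closed_segment_eq_real_ivl split: if_splits)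
  have S': "S \<subseteq> {0..1}" using S by blast
  have xS: "x \<in> S" "y \<in> S" "convex S" by (auto simp: S_def)
  have e0: "e \<ge> 0" using e[OF xy(1)] by simp
  have 1: "\<bar>ux z - ux x - (z - x) * uxx x\<bar> \<le> e * \<bar>y - x\<bar>" if z: "z \<in> S" for z
  proof -
    have "norm ((ux z - z * uxx x) - (ux x - x * uxx x)) \<le> e * norm (z - x)"
    proof (rule field_differentiable_bound[OF xS(3) _ _ z xS(1)])
      fix z assume z: "z \<in> S"
      have "(ux has_real_derivative uxx z) (at z within S)"
        using d2[of z] S[OF z] S' has_field_derivative_subset by blast
      then show "((\<lambda>z. ux z - z * uxx x) has_real_derivative (uxx z - uxx x)) (at z within S)"
        by (auto intro!: derivative_eq_intros)
      show "norm (uxx z - uxx x) \<le> e" using e[of z] S[OF z] by simp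
    qed
    also have "\<dots> \<le> e * \<bar>y - x\<bar>" using S[OF z] e0 by (simp add: mult_left_mono)
    finally show ?thesis by (simp add: algebra_simps)
  qed
  have "norm ((u y - y * ux x - (y - x)\<^sup>2 / 2 * uxx x) - (u x - x * ux x - (x - x)\<^sup>2 / 2 * uxx x))
          \<le> (e * \<bar>y - x\<bar>) * norm (y - x)"
  proof (rule field_differentiable_bound[OF xS(3) _ _ xS(2,1)])
    fix z assume z: "z \<in> S"
    have "(u has_real_derivative ux z) (at z within S)"
      using d1[of z] S[OF z] S' has_field_derivative_subset by blast
    then show "((\<lambda>z. u z - z * ux x - (z - x)\<^sup>2 / 2 * uxx x) has_real_derivative
        (ux z - ux x - (z - x) * uxx x)) (at z within S)"
      by (auto intro!: derivative_eq_intros)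
    show "norm (ux z - ux x - (z - x) * uxx x) \<le> e * \<bar>y - x\<bar>" using 1[OF z] by simp
  qed
  then show ?thesis by (simp add: algebra_simps power2_eq_square flip: abs_mult)
qed

text \<open>
  At a boundary node one of the two neighbour differences vanishes, so half of \<open>uxx\<close> is lost there.
\<close>
lemma disc_lap_consistency:
  fixes u ux uxx :: "real \<Rightarrow> real"
  assumes d1: "\<And>y. y \<in> {0..1} \<Longrightarrow> (u has_real_derivative ux y) (at y within {0..1})"
    and d2: "\<And>y. y \<in> {0..1} \<Longrightarrow> (ux has_real_derivative uxx y) (at y within {0..1})"
    and bc: "ux 0 = 0" "ux 1 = 0" and J: "J \<ge> 1" "j \<le> J"
    and e: "\<And>y z. y \<in> {0..1} \<Longrightarrow> z \<in> {0..1} \<Longrightarrow> \<bar>y - z\<bar> \<le> 1 / real J \<Longrightarrow> \<bar>uxx y - uxx z\<bar> \<le> e"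
    and M: "\<And>y. y \<in> {0..1} \<Longrightarrow> \<bar>uxx y\<bar> \<le> M"
  shows "\<bar>disc_lap J (\<lambda>j. u (real j / real J)) j / (1 / real J)\<^sup>2 - uxx (real j / real J)\<bar>
           \<le> 2 * e + (if j \<in> {0,J} then M else 0)"
proof -
  define dx where "dx = 1 / real J"
  define x where "x = real j / real J"
  define b where "b = (if j \<in> {0,J} then M else 0)"
  have dx: "dx > 0" and x: "x \<in> {0..1}" using J by (auto simp: dx_def x_def)
  have e0: "e \<ge> 0" using e[of 0 0] by simp
  have M0: "M \<ge> 0" using M[of 0] by simp
  have b0: "b \<ge> 0" using M0 by (simp add: b_def)
  define p where "p = u (real (min (Suc j) J) / real J) - u x"
  define q where "q = u (real (j - 1) / real J) - u x"
  have lap: "disc_lap J (\<lambda>j. u (real j / real J)) j = p + q"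
    by (simp add: disc_lap_def p_def q_def x_def)
  have bd: "\<bar>dx\<^sup>2 / 2 * uxx x\<bar> \<le> M / 2 * dx\<^sup>2"
    using mult_right_mono[OF M[OF x], of "dx\<^sup>2"] by (simp add: abs_mult mult.commute)
  \<comment> \<open>Allowing \<open>b / 2\<close> in both one-sided estimates makes them add up to
    \<open>2 * e + b\<close> whichever end the node is at; the first-order terms
    \<open>dx * ux x\<close> cancel between \<open>P\<close> and \<open>Q\<close>.\<close>
  have P: "\<bar>p - dx * ux x - dx\<^sup>2 / 2 * uxx x\<bar> \<le> (e + b / 2) * dx\<^sup>2"
  proof (cases "j < J")
    case True
    have y: "real (min (Suc j) J) / real J = x + dx" "x + dx \<in> {0..1}"
      using True J by (auto simp: x_def dx_def min_def field_simps)
    have "\<bar>u (x + dx) - u x - (x + dx - x) * ux x - (x + dx - x)\<^sup>2 / 2 * uxx x\<bar> \<le> e * (x + dx - x)\<^sup>2"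
      by (rule second_order_taylor[OF d1 d2 x y(2)]) (use e x dx in \<open>auto simp: dx_def\<close>)
    moreover have "e * dx\<^sup>2 \<le> (e + b / 2) * dx\<^sup>2" using b0 by (simp add: mult_right_mono)
    ultimately show ?thesis by (simp add: p_def y(1))
  next
    case False
    then have j: "j = J" "x = 1" using J by (auto simp: x_def)
    have "p = 0" using J by (simp add: p_def j x_def)
    moreover have "M / 2 * dx\<^sup>2 \<le> (e + b / 2) * dx\<^sup>2"
      using e0 j by (intro mult_right_mono) (auto simp: b_def)
    ultimately show ?thesis using bd bc j by simp
  qed
  have Q: "\<bar>q + dx * ux x - dx\<^sup>2 / 2 * uxx x\<bar> \<le> (e + b / 2) * dx\<^sup>2"
  proof (cases "j > 0")
    case True
    have y: "real (j - 1) / real J = x - dx" "x - dx \<in> {0..1}"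
      using True J by (auto simp: x_def dx_def field_simps of_nat_diff)
    have "\<bar>u (x - dx) - u x - (x - dx - x) * ux x - (x - dx - x)\<^sup>2 / 2 * uxx x\<bar> \<le> e * (x - dx - x)\<^sup>2"
      by (rule second_order_taylor[OF d1 d2 x y(2)]) (use e x dx in \<open>auto simp: dx_def\<close>)
    moreover have "e * dx\<^sup>2 \<le> (e + b / 2) * dx\<^sup>2" using b0 by (simp add: mult_right_mono)
    ultimately show ?thesis unfolding q_def y(1) by simp
  next
    case False
    then have j: "j = 0" "x = 0" using J by (auto simp: x_def)
    have "q = 0" by (simp add: q_def j)
    moreover have "M / 2 * dx\<^sup>2 \<le> (e + b / 2) * dx\<^sup>2"
      using e0 j by (intro mult_right_mono) (auto simp: b_def)
    ultimately show ?thesis using bd bc j by simp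
  qed
  have "\<bar>p + q - dx\<^sup>2 * uxx x\<bar> \<le> (2 * e + b) * dx\<^sup>2"
    using P Q by (simp add: algebra_simps)
  then have "\<bar>p + q - dx\<^sup>2 * uxx x\<bar> / dx\<^sup>2 \<le> 2 * e + b"
    using dx by (simp add: divide_le_eq)
  also have "\<bar>p + q - dx\<^sup>2 * uxx x\<bar> / dx\<^sup>2 = \<bar>(p + q) / dx\<^sup>2 - uxx x\<bar>"
    using dx by (intro abs_diff_divide_pos) simp
  finally show ?thesis unfolding lap dx_def x_def b_def .
qed

section \<open>Grid functions, vanishing mesh errors and the truncation error\<close>

definition grid :: "real \<Rightarrow> (real \<Rightarrow> real \<Rightarrow> real) \<Rightarrow> nat \<Rightarrow> nat \<Rightarrow> nat \<Rightarrow> nat \<Rightarrow> real" where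
  "grid T u I J i j = u (T * real i / real I) (real j / real J)"

text \<open>Convergence to 0 in \<open>disc_norm\<close> as \<open>I\<close> and \<open>J\<close>
  grow independently. The weight \<open>1 / (J + 1)\<close> of that norm is moved to the right as
  \<open>sqrt (J + 1)\<close>, so that the library facts on \<open>L2_set\<close> apply row by
  row.\<close>

definition grid_null :: "(nat \<Rightarrow> nat \<Rightarrow> nat \<Rightarrow> nat \<Rightarrow> real) \<Rightarrow> bool" where
  "grid_null w \<longleftrightarrow>
     (\<forall>e>0. \<exists>N. \<forall>I\<ge>N. \<forall>J\<ge>N. \<forall>i\<le>I. L2_set (w I J i) {..J} \<le> e * sqrt (real J + 1))"

lemma grid_nullD:
  assumes "grid_null w" "e > 0"
  shows "\<exists>N. \<forall>I\<ge>N. \<forall>J\<ge>N. \<forall>i\<le>I. L2_set (w I J i) {..J} \<le> e * sqrt (real J + 1)"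
  using assms unfolding grid_null_def by blast

lemma grid_nullI:
  assumes C: "C > 0"
    and "\<And>e. e > 0 \<Longrightarrow>
      \<exists>N. \<forall>I\<ge>N. \<forall>J\<ge>N. \<forall>i\<le>I. L2_set (w I J i) {..J} \<le> C * e * sqrt (real J + 1)"
  shows "grid_null w"
  unfolding grid_null_def
proof (intro allI impI)
  fix e :: real assume "e > 0"
  then show "\<exists>N. \<forall>I\<ge>N. \<forall>J\<ge>N. \<forall>i\<le>I. L2_set (w I J i) {..J} \<le> e * sqrt (real J + 1)"
    using assms(2)[of "e / C"] C by simp
qed

lemma compact_uniform_modulus:
  fixes g :: "real \<Rightarrow> real \<Rightarrow> real"
  assumes g: "continuous_on ({0..T} \<times> {0..1}) (\<lambda>(t,x). g t x)" and e: "e > 0"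
  obtains d where "d > 0"
    "\<And>s t x y. s \<in> {0..T} \<Longrightarrow> t \<in> {0..T} \<Longrightarrow> x \<in> {0..1} \<Longrightarrow> y \<in> {0..1} \<Longrightarrow>
       \<bar>s - t\<bar> + \<bar>x - y\<bar> < d \<Longrightarrow> \<bar>g s x - g t y\<bar> \<le> e"
proof -
  have "uniformly_continuous_on ({0..T} \<times> {0..1}) (\<lambda>(t,x). g t x)"
    by (rule compact_uniformly_continuous[OF g]) (auto intro: compact_Times)
  then obtain d where d: "d > 0"
    "\<And>p q. p \<in> {0..T} \<times> {0..1} \<Longrightarrow> q \<in> {0..T} \<times> {0..1} \<Longrightarrow> dist q p < d \<Longrightarrow>
       dist ((\<lambda>(t,x). g t x) q) ((\<lambda>(t,x). g t x) p) < e"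
    using e unfolding uniformly_continuous_on_def by metis
  show thesis
  proof (rule that[OF d(1)])
    fix s t x y :: real
    assume A: "s \<in> {0..T}" "t \<in> {0..T}" "x \<in> {0..1}" "y \<in> {0..1}" "\<bar>s - t\<bar> + \<bar>x - y\<bar> < d"
    have "dist (s,x) (t,y) \<le> \<bar>s - t\<bar> + \<bar>x - y\<bar>"
      by (simp add: dist_prod_def dist_real_def sqrt_sum_squares_le_sum_abs)
    then show "\<bar>g s x - g t y\<bar> \<le> e"
      using d(2)[of "(t,y)" "(s,x)"] A by (simp add: dist_real_def)
  qed
qed

lemma compact_uniform_bound:
  fixes g :: "real \<Rightarrow> real \<Rightarrow> real"
  assumes g: "continuous_on ({0..T} \<times> {0..1}) (\<lambda>(t,x). g t x)"
  obtains M where "M > 0" "\<And>t x. t \<in> {0..T} \<Longrightarrow> x \<in> {0..1} \<Longrightarrow> \<bar>g t x\<bar> \<le> M"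
proof -
  have "compact ((\<lambda>(t,x). g t x) ` ({0..T} \<times> {0..1}))"
    by (rule compact_continuous_image[OF g]) (auto intro: compact_Times)
  from compact_imp_bounded[OF this] obtain M where "M > 0"
      "\<And>y. y \<in> (\<lambda>(t,x). g t x) ` ({0..T} \<times> {0..1}) \<Longrightarrow> norm y \<le> M"
    unfolding bounded_pos by blast
  then show thesis by (intro that[of M]) force+
qed

lemma parabolic_continuous:
  "parabolic T a u h \<Longrightarrow> continuous_on ({0..T} \<times> {0..1}) (\<lambda>(t,x). u t x)"
  by (auto simp: parabolic_def C12_with_def)

text \<open>The truncation error \<open>\<rho>\<close> is defined as the exact defect of the sampled
  solution, so the discrete equation holds by definition and the content is that the defect is null
  in mean square.\<close>

lemma grid_consistency:
  assumes T: "T > 0" and a: "a \<ge> 0"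
    and u: "parabolic T a u h" and h: "continuous_on ({0..T} \<times> {0..1}) (\<lambda>(t,x). h t x)"
  obtains \<rho> where
    "\<And>I J. I \<ge> 1 \<Longrightarrow> J \<ge> 1 \<Longrightarrow>
       disc_parabolic T a I J (grid T u I J) (\<lambda>i j. grid T h I J i j + \<rho> I J i j)"
    "grid_null \<rho>"
proof -
  obtain ut ux uxx where C: "C12_with T u ut ux uxx"
      and pde: "\<And>t x. t\<in>{0<..<T} \<Longrightarrow> x\<in>{0<..<1} \<Longrightarrow> ut t x - a * uxx t x = h t x"
      and bc: "\<And>t. t\<in>{0..T} \<Longrightarrow> ux t 0 = 0 \<and> ux t 1 = 0"
    using u unfolding parabolic_def by blast
  note Cd = C[unfolded C12_with_def]
  let ?Q = "{0..T} \<times> {0..1::real}"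
  \<comment> \<open>Grid nodes also lie on the boundary of the rectangle; continuity extends the
    equation to them, through the two inequalities with \<open>d\<close> constantly 1.\<close>
  have pde': "ut t x - a * uxx t x = h t x" if "t \<in> {0..T}" "x \<in> {0..1}" for t x
  proof -
    have c: "continuous_on ?Q (\<lambda>(t,x). ut t x - a * uxx t x - h t x)"
      unfolding case_prod_unfold using Cd h
      by (intro continuous_intros) (auto simp: case_prod_unfold)
    have "(\<lambda>(t,x). ut t x - a * uxx t x - h t x) (t,x) \<le> 0"
      by (rule le_zero_from_interior[OF T c, where d = "\<lambda>_. 1"]) (use that pde in auto)
    moreover have "(\<lambda>p. - (\<lambda>(t,x). ut t x - a * uxx t x - h t x) p) (t,x) \<le> 0"
      by (rule le_zero_from_interior[OF T continuous_on_minus[OF c], where d = "\<lambda>_. 1"])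
         (use that pde in auto)
    ultimately show ?thesis by simp
  qed
  \<comment> \<open>The value 0 at level 0 is a convention: no step ends there, but nullness is
    demanded for that row too.\<close>
  define \<rho> where "\<rho> I J i j = (if i = 0 then 0 else
     (grid T u I J i j - grid T u I J (i - 1) j) / (T / real I)
       - a * disc_lap J (grid T u I J i) j / (1 / real J)\<^sup>2 - grid T h I J i j)" for I J i j
  show thesis
  proof (rule that)
    fix I J :: nat
    show "disc_parabolic T a I J (grid T u I J) (\<lambda>i j. grid T h I J i j + \<rho> I J i j)"
      unfolding disc_parabolic_def by (simp add: \<rho>_def)
  next
    obtain M where M: "M > 0" "\<And>t x. t \<in> {0..T} \<Longrightarrow> x \<in> {0..1} \<Longrightarrow> \<bar>uxx t x\<bar> \<le> M"
      using compact_uniform_bound Cd by blast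
    show "grid_null \<rho>"
    proof (rule grid_nullI)
      show "2 + 2 * a > 0" using a by simp
      fix e :: real assume e: "e > 0"
      obtain d1 where d1: "d1 > 0"
        "\<And>s t x y. s \<in> {0..T} \<Longrightarrow> t \<in> {0..T} \<Longrightarrow> x \<in> {0..1} \<Longrightarrow> y \<in> {0..1} \<Longrightarrow>
           \<bar>s - t\<bar> + \<bar>x - y\<bar> < d1 \<Longrightarrow> \<bar>ut s x - ut t y\<bar> \<le> e"
        using compact_uniform_modulus[OF _ e] Cd by metis
      obtain d2 where d2: "d2 > 0"
        "\<And>s t x y. s \<in> {0..T} \<Longrightarrow> t \<in> {0..T} \<Longrightarrow> x \<in> {0..1} \<Longrightarrow> y \<in> {0..1} \<Longrightarrow>
           \<bar>s - t\<bar> + \<bar>x - y\<bar> < d2 \<Longrightarrow> \<bar>uxx s x - uxx t y\<bar> \<le> e"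
        using compact_uniform_modulus[OF _ e] Cd by metis
      obtain N1 where N1: "real N1 > T / d1" using reals_Archimedean2 by blast
      obtain N2 where N2: "real N2 > 1 / d2" using reals_Archimedean2 by blast
      \<comment> \<open>The two end nodes together contribute at most \<open>2 * a * M\<close> to
        the unnormalised norm; this threshold makes that smaller than
        \<open>e * sqrt (J + 1)\<close>.\<close>
      obtain N3 where N3: "real N3 > (2 * a * M / e)\<^sup>2" using reals_Archimedean2 by blast
      define N where "N = N1 + N2 + N3 + 1"
      show "\<exists>N. \<forall>I\<ge>N. \<forall>J\<ge>N. \<forall>i\<le>I. L2_set (\<rho> I J i) {..J} \<le> (2 + 2 * a) * e * sqrt (real J + 1)"
      proof (intro exI allI impI)
        fix I J i assume IJ: "N \<le> I" "N \<le> J" and iI: "i \<le> I"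
        have IJ1: "I \<ge> 1" "J \<ge> 1" using IJ by (auto simp: N_def)
        have "T / d1 < real I" using N1 IJ by (simp add: N_def)
        then have dt: "T / real I < d1" using d1(1) IJ1 by (simp add: field_simps)
        have "1 / d2 < real J" using N2 IJ by (simp add: N_def)
        then have dx: "1 / real J < d2" using d2(1) IJ1 by (simp add: field_simps)
        have "(2 * a * M / e)\<^sup>2 \<le> real J + 1" using N3 IJ by (simp add: N_def)
        then have "2 * a * M / e \<le> sqrt (real J + 1)"
          by (rule real_le_rsqrt)
        then have bnd: "2 * (a * M) \<le> e * sqrt (real J + 1)" using e by (simp add: field_simps)
        show "L2_set (\<rho> I J i) {..J} \<le> (2 + 2 * a) * e * sqrt (real J + 1)"
        proof (cases "i = 0")
          case True
          then show ?thesis using e a by (simp add: \<rho>_def L2_set_0')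
        next
          case False
          \<comment> \<open>Error away from the end nodes: \<open>e\<close> from the time difference
            and \<open>a * (2 * e)\<close> from the space difference. The end nodes add one further
            \<open>e\<close>, whence the factor \<open>2 + 2 * a\<close>.\<close>
          define k where "k = (1 + 2 * a) * e"
          define b where "b j = (if j \<in> {0,J} then a * M else 0)" for j :: nat
          have k0: "k \<ge> 0" using a e by (simp add: k_def)
          have b0: "b j \<ge> 0" for j using a M by (simp add: b_def)
          have le: "\<bar>\<rho> I J i j\<bar> \<le> k + b j" if j: "j \<le> J" for j
          proof -
            define t where "t = T * real i / real I"
            define t' where "t' = T * real (i - 1) / real I"
            define x where "x = real j / real J"
            have x: "x \<in> {0..1}" using j IJ1 by (simp add: x_def)
            have tT: "t \<in> {0..T}" "t' \<in> {0..T}"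
              using iI T IJ1 by (auto simp: t_def t'_def field_simps)
            have tt: "t = t' + T / real I"
              using False by (cases i) (auto simp: t_def t'_def add_divide_distrib distrib_left)
            have dt0: "T / real I > 0" using T IJ1 by simp
            have sub: "{t'..t} \<subseteq> {0..T}" using tT by auto
            have "norm ((u t x - t * ut t x) - (u t' x - t' * ut t x)) \<le> e * norm (t - t')"
            proof (rule field_differentiable_bound[where S = "{t'..t}" and f' = "\<lambda>s. ut s x - ut t x"])
              fix s assume s: "s \<in> {t'..t}"
              have "((\<lambda>s. u s x) has_real_derivative ut s x) (at s within {t'..t})"
                using Cd s sub x has_field_derivative_subset by blast
              then show "((\<lambda>s. u s x - s * ut t x) has_real_derivative ut s x - ut t x) (at s within {t'..t})"
                by (auto intro!: derivative_eq_intros)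
              show "norm (ut s x - ut t x) \<le> e"
                using d1(2)[of s t x x] s sub tT x dt tt by auto
            qed (use tt dt0 in auto)
            then have "\<bar>u t x - u t' x - (T / real I) * ut t x\<bar> \<le> e * (T / real I)"
              using dt0 T by (simp add: tt algebra_simps)
            then have "\<bar>u t x - u t' x - (T / real I) * ut t x\<bar> / (T / real I) \<le> e"
              using dt0 by (simp only: pos_divide_le_eq)
            also have "\<bar>u t x - u t' x - (T / real I) * ut t x\<bar> / (T / real I)
                = \<bar>(u t x - u t' x) / (T / real I) - ut t x\<bar>"
              using dt0 by (rule abs_diff_divide_pos)
            finally have A: "\<bar>(u t x - u t' x) / (T / real I) - ut t x\<bar> \<le> e" .
            have B: "\<bar>disc_lap J (\<lambda>j. u t (real j / real J)) j / (1 / real J)\<^sup>2 - uxx t (real j / real J)\<bar>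
                \<le> 2 * e + (if j \<in> {0,J} then M else 0)"
              by (rule disc_lap_consistency[where ux = "ux t"])
                 (use Cd tT bc IJ1 j dx d2(2) M(2) in \<open>auto\<close>)
            define P where "P = (u t x - u t' x) / (T / real I) - ut t x"
            define Q where "Q = disc_lap J (\<lambda>j. u t (real j / real J)) j / (1 / real J)\<^sup>2 - uxx t x"
            have eq: "\<rho> I J i j = P - a * Q"
              using pde'[OF tT(1) x, symmetric] False
              by (simp add: \<rho>_def P_def Q_def grid_def[abs_def] t_def t'_def x_def right_diff_distrib)
            have "\<bar>P - a * Q\<bar> \<le> \<bar>P\<bar> + \<bar>a * Q\<bar>" by (rule abs_triangle_ineq4)
            also have "\<bar>a * Q\<bar> = a * \<bar>Q\<bar>" using a by (simp add: abs_mult)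
            also have "\<bar>P\<bar> + a * \<bar>Q\<bar> \<le> e + a * (2 * e + (if j \<in> {0,J} then M else 0))"
              using A B a unfolding P_def Q_def x_def by (intro add_mono mult_left_mono)
            finally have "\<bar>\<rho> I J i j\<bar> \<le> e + a * (2 * e + (if j \<in> {0,J} then M else 0))"
              unfolding eq .
            then show ?thesis by (auto simp: k_def b_def algebra_simps split: if_splits)
          qed
          have "L2_set (\<rho> I J i) {..J} = L2_set (\<lambda>j. \<bar>\<rho> I J i j\<bar>) {..J}"
            by (simp add: L2_set_def)
          also have "\<dots> \<le> L2_set (\<lambda>j. k + b j) {..J}"
            using le by (intro L2_set_mono) auto
          also have "\<dots> \<le> L2_set (\<lambda>j. k) {..J} + L2_set b {..J}"
            by (rule L2_set_triangle_ineq)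
          also have "L2_set (\<lambda>j. k) {..J} = k * sqrt (real J + 1)"
            using k0 by (simp add: L2_set_constant add.commute)
          also have "L2_set b {..J} \<le> sum b {..J}"
            using b0 by (intro L2_set_le_sum) auto
          also have "sum b {..J} = 2 * (a * M)"
          proof -
            have "sum b {..J} = sum b {0,J}"
              by (rule sum.mono_neutral_right) (auto simp: b_def)
            then show ?thesis using IJ1 by (simp add: b_def)
          qed
          also note bnd
          finally show ?thesis by (simp add: k_def algebra_simps)
        qed
      qed
    qed
  qed
qed

lemma L2_set_abs_le:
  assumes "\<And>j. j \<in> S \<Longrightarrow> \<bar>f j\<bar> \<le> \<bar>g j\<bar>"
  shows "L2_set f S \<le> L2_set g S"
proof -
  have "L2_set (\<lambda>j. \<bar>f j\<bar>) S \<le> L2_set (\<lambda>j. \<bar>g j\<bar>) S"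
    by (rule L2_set_mono) (use assms in auto)
  then show ?thesis by (simp add: L2_set_def)
qed

lemma unit_grid: "j \<le> J \<Longrightarrow> real j / real J \<in> {0..1}"
  by (auto simp: divide_le_eq)

lemma grid_in_domain:
  assumes "T \<ge> 0" "i \<le> I" "j \<le> J"
  shows "T * real i / real I \<in> {0..T}" "real j / real J \<in> {0..1}"
  using assms unit_grid by (auto simp: divide_le_eq mult_left_mono)

text \<open>Equality is required only for meshes with \<open>I, J \<ge> 1\<close> and indices in
  range: the schemes are assumed only there, and reversing the index by \<open>I - i\<close> makes
  sense only for \<open>i \<le> I\<close>.\<close>

lemma grid_null_cong:
  assumes w: "grid_null w"
    and eq: "\<And>I J i j. I \<ge> 1 \<Longrightarrow> J \<ge> 1 \<Longrightarrow> i \<le> I \<Longrightarrow> j \<le> J \<Longrightarrow> w' I J i j = w I J i j"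
  shows "grid_null w'"
  unfolding grid_null_def
proof (intro allI impI)
  fix e :: real assume "e > 0"
  then obtain N where N: "\<And>I J i. I \<ge> N \<Longrightarrow> J \<ge> N \<Longrightarrow> i \<le> I \<Longrightarrow> L2_set (w I J i) {..J} \<le> e * sqrt (real J + 1)"
    using grid_nullD[OF w] by blast
  have "L2_set (w' I J i) {..J} \<le> e * sqrt (real J + 1)" if "Suc N \<le> I" "Suc N \<le> J" "i \<le> I" for I J i
  proof -
    have "L2_set (w' I J i) {..J} = L2_set (w I J i) {..J}"
      using that by (intro L2_set_cong eq) auto
    then show ?thesis using N[of I J i] that by simp
  qed
  then show "\<exists>N. \<forall>I\<ge>N. \<forall>J\<ge>N. \<forall>i\<le>I. L2_set (w' I J i) {..J} \<le> e * sqrt (real J + 1)" by blast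
qed

subsection \<open>Time reversal\<close>

lemma grid_null_reverse: "grid_null w \<Longrightarrow> grid_null (\<lambda>I J i. w I J (I - i))"
  unfolding grid_null_def by (meson diff_le_self)

lemma grid_reverse:
  assumes "I \<ge> 1" "i \<le> I"
  shows "grid T (\<lambda>t. u (T - t)) I J i j = grid T u I J (I - i) j"
proof -
  have "T - T * real i / real I = T * real (I - i) / real I"
    using assms by (simp add: of_nat_diff field_simps)
  then show ?thesis by (simp add: grid_def)
qed

lemma C12_with_reverse:
  assumes "C12_with T u ut ux uxx"
  shows "C12_with T (\<lambda>t. u (T - t)) (\<lambda>t x. - ut (T - t) x) (\<lambda>t. ux (T - t)) (\<lambda>t. uxx (T - t))"
proof -
  note C = assms[unfolded C12_with_def]
  have c: "continuous_on ({0..T} \<times> {0..1}) (\<lambda>(t,x). g (T - t) x)"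
    if g: "continuous_on ({0..T} \<times> {0..1}) (\<lambda>(t,x). g t x)" for g :: "real \<Rightarrow> real \<Rightarrow> real"
  proof -
    have "continuous_on ({0..T} \<times> {0..1::real}) (\<lambda>p. (\<lambda>(t,x). g t x) (T - fst p, snd p))"
      by (rule continuous_on_compose2[OF g]) (auto intro!: continuous_intros)
    then show ?thesis by (simp add: case_prod_unfold)
  qed
  have cm: "continuous_on ({0..T} \<times> {0..1}) (\<lambda>(t,x). - ut (T - t) x)"
    using continuous_on_minus[OF c[of ut]] C by (simp add: case_prod_unfold)
  have dt: "((\<lambda>s. u (T - s) x) has_real_derivative - ut (T - t) x) (at t within {0..T})"
    if "t \<in> {0..T}" "x \<in> {0..1}" for t x
  proof -
    \<comment> \<open>The reversal maps the time interval onto itself, so the chain rule respects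
      the one-sided derivatives at both ends.\<close>
    have "(-) T ` {0..T} = {0..T}" by simp
    moreover have "((\<lambda>s. u s x) has_real_derivative ut (T - t) x) (at (T - t) within {0..T})"
      using C that by auto
    ultimately have "((\<lambda>s. u s x) has_real_derivative ut (T - t) x) (at (T - t) within ((-) T) ` {0..T})"
      by simp
    moreover have "((-) T has_real_derivative - 1) (at t within {0..T})"
      by (auto intro!: derivative_eq_intros)
    ultimately have "((\<lambda>s. u s x) \<circ> (-) T has_real_derivative ut (T - t) x * - 1) (at t within {0..T})"
      by (rule DERIV_image_chain)
    then show ?thesis by (simp add: o_def)
  qed
  show ?thesis
    unfolding C12_with_def using C c[of u] c[of ux] c[of uxx] cm dt by auto
qed

text \<open>Supplies the barriers for the comparison principle: functions of time alone satisfy the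
  Neumann condition and have no diffusion term.\<close>

lemma parabolic_spatially_constant:
  assumes "\<And>t. (g has_real_derivative g' t) (at t)" "continuous_on {0..T} g'"
  shows "parabolic T a (\<lambda>t x. g t) (\<lambda>t x. g' t)"
proof -
  have g: "continuous_on UNIV g"
    using assms(1) by (meson DERIV_isCont continuous_at_imp_continuous_on)
  have "continuous_on ({0..T} \<times> {0..1::real}) (\<lambda>p. g (fst p))"
       "continuous_on ({0..T} \<times> {0..1::real}) (\<lambda>p. g' (fst p))"
    by (rule continuous_on_compose2[OF g] continuous_on_compose2[OF assms(2)];
        auto intro!: continuous_intros)+
  then have "C12_with T (\<lambda>t x. g t) (\<lambda>t x. g' t) (\<lambda>_ _. 0) (\<lambda>_ _. 0)"
    using assms(1) by (auto simp: C12_with_def case_prod_unfold has_field_derivative_at_within)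
  then show ?thesis unfolding parabolic_def by fastforce
qed

subsection \<open>Equations with the reaction term\<close>

text \<open>The bound \<open>B\<close> is a parameter because it enters the decay rate
  \<open>B / \<sigma>\<^sup>2\<close> of the lower barriers.\<close>

locale coupling =
  fixes \<sigma> K B :: real and f :: "real \<Rightarrow> real \<Rightarrow> real"
  assumes sigma_pos: "\<sigma> > 0"
    and f_cont: "continuous_on ({0..1} \<times> UNIV) (\<lambda>(x, \<xi>). f x \<xi>)"
    and f_noninc: "\<And>x \<xi>1 \<xi>2. x \<in> {0..1} \<Longrightarrow> \<xi>1 \<le> \<xi>2 \<Longrightarrow> f x \<xi>2 \<le> f x \<xi>1"
    and f_bdd: "\<And>x \<xi>. x \<in> {0..1} \<Longrightarrow> \<bar>f x \<xi>\<bar> \<le> B"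
    and f_nonpos: "\<And>x \<xi>. x \<in> {0..1} \<Longrightarrow> f x \<xi> \<le> 0"
    and f_lip: "\<And>x \<xi>1 \<xi>2. x \<in> {0..1} \<Longrightarrow> \<xi>1 \<ge> 0 \<Longrightarrow> \<xi>2 \<ge> 0 \<Longrightarrow>
                  \<bar>f x \<xi>2 - f x \<xi>1\<bar> \<le> K * \<bar>\<xi>2 - \<xi>1\<bar>"
begin

text \<open>The reaction term shared by both equations once time is reversed in the backward one:
  \<open>v\<close> is the unknown and \<open>p\<close> the other component, frozen from the
  preceding half-step.\<close>

definition source :: "real \<Rightarrow> real \<Rightarrow> real \<Rightarrow> real" where
  "source x v p = 1 / \<sigma>\<^sup>2 * f x (v * p) * v"

text \<open>Nonpositivity of \<open>f\<close> handles the outer factor, monotonicity of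
  \<open>f\<close> its argument. Ordering the products rather than \<open>p\<close> and
  \<open>q\<close> covers both uses: equal coefficients in the error estimate, ordered ones in the
  monotonicity of the iteration.\<close>

lemma source_antimono:
  assumes x: "x \<in> {0..1}" and v: "0 \<le> v" "v \<le> u" and le: "v * p \<le> u * q"
  shows "source x u q \<le> source x v p"
proof -
  have "f x (u * q) * u \<le> f x (u * q) * v"
    using f_nonpos[OF x] v by (intro mult_left_mono_neg)
  also have "\<dots> \<le> f x (v * p) * v"
    using f_noninc[OF x le] v by (intro mult_right_mono)
  finally show ?thesis
    using sigma_pos by (simp add: source_def divide_right_mono)
qed

text \<open>One factor \<open>u\<close> comes from the argument of \<open>f\<close> and one from the
  outer factor. Nonnegative arguments keep the estimate in the range where \<open>f\<close> is
  Lipschitz.\<close>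

lemma source_lipschitz:
  assumes x: "x \<in> {0..1}" and u: "0 \<le> u" and pq: "0 \<le> p" "0 \<le> q"
  shows "\<bar>source x u p - source x u q\<bar> \<le> \<bar>K\<bar> / \<sigma>\<^sup>2 * u\<^sup>2 * \<bar>p - q\<bar>"
proof -
  have "\<bar>f x (u * p) - f x (u * q)\<bar> \<le> K * \<bar>u * p - u * q\<bar>"
    using f_lip[OF x, of "u * q" "u * p"] u pq by simp
  also have "\<dots> \<le> \<bar>K\<bar> * \<bar>u * p - u * q\<bar>" by (intro mult_right_mono) auto
  also have "\<bar>u * p - u * q\<bar> = u * \<bar>p - q\<bar>"
    using u by (simp add: abs_mult flip: right_diff_distrib)
  finally have "\<bar>f x (u * p) - f x (u * q)\<bar> * u / \<sigma>\<^sup>2 \<le> (\<bar>K\<bar> * (u * \<bar>p - q\<bar>)) * u / \<sigma>\<^sup>2"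
    using u by (intro divide_right_mono mult_right_mono) auto
  also have "\<bar>f x (u * p) - f x (u * q)\<bar> * u / \<sigma>\<^sup>2 = \<bar>source x u p - source x u q\<bar>"
  proof -
    have "source x u p - source x u q = (f x (u * p) - f x (u * q)) * u / \<sigma>\<^sup>2"
      by (simp add: source_def left_diff_distrib diff_divide_distrib)
    then show ?thesis using u by (simp add: abs_mult)
  qed
  finally show ?thesis by (simp add: power2_eq_square mult_ac)
qed

lemma source_neg: "x \<in> {0..1} \<Longrightarrow> v \<le> 0 \<Longrightarrow> 0 \<le> source x v p"
  using f_nonpos[of x "v * p"] sigma_pos
  by (simp add: source_def zero_le_mult_iff)

lemma source_ge:
  assumes x: "x \<in> {0..1}" and v: "0 \<le> v" "v \<le> w"
  shows "- (B / \<sigma>\<^sup>2) * w \<le> source x v p"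
proof -
  have "- f x (v * p) * v \<le> B * w"
    using f_bdd[OF x, of "v * p"] v by (intro mult_mono) auto
  then have "- (B * w) / \<sigma>\<^sup>2 \<le> (f x (v * p) * v) / \<sigma>\<^sup>2"
    by (intro divide_right_mono) auto
  then show ?thesis by (simp add: source_def)
qed

lemma source_continuous:
  assumes u: "continuous_on ({0..T} \<times> {0..1}) (\<lambda>(t,x). u t x)"
    and q: "continuous_on ({0..T} \<times> {0..1}) (\<lambda>(t,x). q t x)"
  shows "continuous_on ({0..T} \<times> {0..1}) (\<lambda>(t,x). source x (u t x) (q t x))"
proof -
  have "continuous_on ({0..T} \<times> {0..1})
      (\<lambda>p. (\<lambda>(x,\<xi>). f x \<xi>) (snd p, (\<lambda>(t,x). u t x) p * (\<lambda>(t,x). q t x) p))"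
    by (rule continuous_on_compose2[OF f_cont]) (auto intro!: continuous_intros u q)
  then show ?thesis unfolding source_def case_prod_unfold
    using u by (intro continuous_intros) (auto simp: case_prod_unfold)
qed

section \<open>Nonnegativity and lower bounds, continuous and discrete\<close>

lemma half_sigma2_nonneg: "\<sigma>\<^sup>2 / 2 \<ge> 0" by simp

lemma B_nonneg: "B \<ge> 0"
  using f_bdd[of 0 0] by simp

lemma solution_nonneg:
  assumes T: "T > 0" and u: "parabolic T (\<sigma>\<^sup>2 / 2) u (\<lambda>t x. source x (u t x) (q t x))"
    and init: "\<And>x. x \<in> {0..1} \<Longrightarrow> u 0 x \<ge> 0" and tx: "t \<in> {0..T}" "x \<in> {0..1}"
  shows "u t x \<ge> 0"
  by (rule parabolic_comparison[OF T half_sigma2_nonneg parabolic_spatially_constant[where g = "\<lambda>_. 0" and g' = "\<lambda>_. 0"] u _ init tx])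
     (auto intro: source_neg)

text \<open>The barrier solves \<open>g' = - b * g\<close> with
  \<open>b = B / \<sigma>\<^sup>2\<close>; where the solution lies between 0 and the barrier, the
  source is at least \<open>- b * g\<close>. The bound does not involve \<open>q\<close>, hence it
  holds for all iterates at once.\<close>

lemma solution_lower_bound:
  assumes T: "T > 0" and u: "parabolic T (\<sigma>\<^sup>2 / 2) u (\<lambda>t x. source x (u t x) (q t x))"
    and m: "m \<ge> 0" and init: "\<And>x. x \<in> {0..1} \<Longrightarrow> u 0 x \<ge> m" and tx: "t \<in> {0..T}" "x \<in> {0..1}"
  shows "u t x \<ge> m * exp (- (B / \<sigma>\<^sup>2) * T)"
proof -
  define b where "b = B / \<sigma>\<^sup>2"
  have b: "b \<ge> 0" using B_nonneg by (simp add: b_def)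
  have "m * exp (- b * T) \<le> m * exp (- b * t)"
    using m tx b mult_left_mono[of t T b] by (intro mult_left_mono) auto
  also have "\<dots> \<le> u t x"
  proof (rule parabolic_comparison[OF T half_sigma2_nonneg parabolic_spatially_constant[where g = "\<lambda>t. m * exp (- b * t)"
         and g' = "\<lambda>t. - b * (m * exp (- b * t))"] u _ _ tx])
    fix t x :: real assume A: "t \<in> {0<..<T}" "x \<in> {0<..<1}" "u t x < m * exp (- b * t)"
    have "u t x \<ge> 0"
      by (rule solution_nonneg[OF T u]) (use A m init in \<open>auto intro: order_trans\<close>)
    then show "- b * (m * exp (- b * t)) \<le> source x (u t x) (q t x)"
      using A by (intro source_ge[folded b_def]) auto
  qed (use init in \<open>auto intro!: derivative_eq_intros continuous_intros\<close>)
  finally show ?thesis by (simp add: b_def)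
qed

lemma disc_parabolic_spatially_constant:
  "disc_parabolic T a I J (\<lambda>i j. g i) (\<lambda>i j. (g i - g (i - 1)) / (T / real I))"
  by (simp add: disc_parabolic_def disc_lap_def)

lemma disc_solution_nonneg:
  assumes T: "T > 0" and I: "I \<ge> 1"
    and v: "disc_parabolic T (\<sigma>\<^sup>2 / 2) I J v (\<lambda>i j. source (real j / real J) (v i j) (p i j))"
    and init: "\<And>j. j \<le> J \<Longrightarrow> v 0 j \<ge> 0" and ij: "i \<le> I" "j \<le> J"
  shows "v i j \<ge> 0"
  by (rule disc_parabolic_comparison[OF T I half_sigma2_nonneg disc_parabolic_spatially_constant[where g = "\<lambda>_. 0"] v _ init ij])
     (auto intro!: source_neg unit_grid simp del: atLeastAtMost_iff)

text \<open>The barrier is now the implicit Euler solution \<open>m / (1 + b * dt) ^ i\<close> of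
  the same linear decay. As \<open>1 + b * dt \<le> exp (b * dt)\<close>, it stays above the
  continuous bound, so the constant does not depend on the mesh.\<close>

lemma disc_solution_lower_bound:
  assumes T: "T > 0" and I: "I \<ge> 1"
    and v: "disc_parabolic T (\<sigma>\<^sup>2 / 2) I J v (\<lambda>i j. source (real j / real J) (v i j) (p i j))"
    and m: "m \<ge> 0" and init: "\<And>j. j \<le> J \<Longrightarrow> v 0 j \<ge> m" and ij: "i \<le> I" "j \<le> J"
  shows "v i j \<ge> m * exp (- (B / \<sigma>\<^sup>2) * T)"
proof -
  define b where "b = B / \<sigma>\<^sup>2"
  have b: "b \<ge> 0" using B_nonneg by (simp add: b_def)
  define dt where "dt = T / real I"
  have dt: "dt > 0" using T I by (simp add: dt_def)
  define s where "s = 1 + b * dt"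
  have s: "s \<ge> 1" using b dt by (simp add: s_def)
  define g where "g i = m / s ^ i" for i :: nat
  have g0: "g i \<ge> 0" for i using m s by (simp add: g_def)
  have "s ^ i \<le> exp (b * dt) ^ i"
    using s exp_ge_add_one_self[of "b * dt"] by (intro power_mono) (auto simp: s_def)
  also have "\<dots> = exp (b * (dt * real i))" by (simp add: exp_of_nat_mult[symmetric] mult_ac)
  also have "\<dots> \<le> exp (b * T)"
  proof -
    have "dt * real i \<le> dt * real I" using dt ij by simp
    also have "\<dots> = T" using I by (simp add: dt_def)
    finally have "b * (dt * real i) \<le> b * T" using b by (rule mult_left_mono)
    then show ?thesis by simp
  qed
  finally have "m * exp (- b * T) \<le> g i"
    using m s unfolding g_def by (simp add: exp_minus divide_inverse mult_left_mono le_imp_inverse_le)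
  also have "g i \<le> v i j"
  proof (rule disc_parabolic_comparison[OF T I half_sigma2_nonneg disc_parabolic_spatially_constant[where g = g] v _ _ ij])
    fix i j assume A: "i < I" "j \<le> J" "v (Suc i) j < g (Suc i)"
    have "v (Suc i) j \<ge> 0"
      by (rule disc_solution_nonneg[OF T I v]) (use A m init in \<open>auto intro: order_trans\<close>)
    moreover have "real j / real J \<in> {0..1}" using A by (intro unit_grid) simp
    ultimately have "- b * g (Suc i) \<le> source (real j / real J) (v (Suc i) j) (p (Suc i) j)"
      using A by (intro source_ge[folded b_def]) auto
    moreover have "(g (Suc i) - g i) / dt = - b * g (Suc i)"
    proof -
      have "g i = s * g (Suc i)" using s by (simp add: g_def)
      then have "g (Suc i) - g i = - b * g (Suc i) * dt" by (simp add: s_def algebra_simps)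
      then show ?thesis using dt by simp
    qed
    ultimately show "(g (Suc i) - g (Suc i - 1)) / (T / real I)
        \<le> source (real j / real J) (v (Suc i) j) (p (Suc i) j)"
      by (simp add: dt_def)
  qed (use init in \<open>auto simp: g_def\<close>)
  finally show ?thesis by (simp add: b_def)
qed

text \<open>One half-step. With \<open>u\<close> and \<open>q\<close> sampled on the grid,
  \<open>source v p - source u q\<close> is split at \<open>source u p\<close>: the change from
  \<open>v\<close> to \<open>u\<close> has the good sign by \<open>source_antimono\<close>, and the
  change from \<open>p\<close> to \<open>q\<close> is small by \<open>source_lipschitz\<close>.
  Initial values need only converge, since those of \<open>psi\<close> involve the preceding
  discrete \<open>phi\<close>.\<close>

lemma grid_convergence:
  assumes T: "T > 0"
    and u: "parabolic T (\<sigma>\<^sup>2 / 2) u (\<lambda>t x. source x (u t x) (q t x))"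
    and q: "continuous_on ({0..T} \<times> {0..1}) (\<lambda>(t,x). q t x)"
    and nonneg: "\<And>t x. t \<in> {0..T} \<Longrightarrow> x \<in> {0..1} \<Longrightarrow> u t x \<ge> 0 \<and> q t x \<ge> 0"
    and v: "\<And>I J. I \<ge> 1 \<Longrightarrow> J \<ge> 1 \<Longrightarrow>
      disc_parabolic T (\<sigma>\<^sup>2 / 2) I J (v I J) (\<lambda>i j. source (real j / real J) (v I J i j) (p I J i j))"
    and dnonneg: "\<And>I J i j. I \<ge> 1 \<Longrightarrow> J \<ge> 1 \<Longrightarrow> i \<le> I \<Longrightarrow> j \<le> J \<Longrightarrow> v I J i j \<ge> 0 \<and> p I J i j \<ge> 0"
    and pq: "grid_null (\<lambda>I J i j. p I J i j - grid T q I J i j)"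
    and init: "\<And>e. e > 0 \<Longrightarrow> \<exists>N. \<forall>I\<ge>N. \<forall>J\<ge>N.
      L2_set (\<lambda>j. v I J 0 j - u 0 (real j / real J)) {..J} \<le> e * sqrt (real J + 1)"
  shows "grid_null (\<lambda>I J i j. v I J i j - grid T u I J i j)"
proof -
  have uc: "continuous_on ({0..T} \<times> {0..1}) (\<lambda>(t,x). u t x)"
    using u by (rule parabolic_continuous)
  obtain \<rho> where \<rho>: "\<And>I J. I \<ge> 1 \<Longrightarrow> J \<ge> 1 \<Longrightarrow>
       disc_parabolic T (\<sigma>\<^sup>2 / 2) I J (grid T u I J) (\<lambda>i j. grid T (\<lambda>t x. source x (u t x) (q t x)) I J i j + \<rho> I J i j)"
    and \<rho>0: "grid_null \<rho>"
    by (rule grid_consistency[OF T half_sigma2_nonneg u source_continuous[OF uc q]]) blast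
  obtain U where U: "U > 0" "\<And>t x. t \<in> {0..T} \<Longrightarrow> x \<in> {0..1} \<Longrightarrow> \<bar>u t x\<bar> \<le> U"
    using compact_uniform_bound[OF uc] by blast
  define c where "c = \<bar>K\<bar> / \<sigma>\<^sup>2 * U\<^sup>2"
  have c: "c \<ge> 0" by (simp add: c_def)
  \<comment> \<open>In each direction the error is at most 1 unit from the initial data and
    \<open>T\<close> times \<open>c + 1\<close> from the residual, of which \<open>c\<close> is due
    to the coefficient and 1 to the truncation; the factor 2 counts the two directions.\<close>
  have C: "2 * (1 + T * (c + 1)) > 0" using c T by (simp add: add_pos_nonneg)
  show ?thesis
  proof (rule grid_nullI[OF C])
    fix e :: real assume e: "e > 0"
    obtain N1 where N1: "\<forall>I\<ge>N1. \<forall>J\<ge>N1. \<forall>i\<le>I. L2_set (\<lambda>j. p I J i j - grid T q I J i j) {..J} \<le> e * sqrt (real J + 1)"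
      using grid_nullD[OF pq e] by blast
    obtain N2 where N2: "\<forall>I\<ge>N2. \<forall>J\<ge>N2. \<forall>i\<le>I. L2_set (\<rho> I J i) {..J} \<le> e * sqrt (real J + 1)"
      using grid_nullD[OF \<rho>0 e] by blast
    obtain N3 where N3: "\<forall>I\<ge>N3. \<forall>J\<ge>N3. L2_set (\<lambda>j. v I J 0 j - u 0 (real j / real J)) {..J} \<le> e * sqrt (real J + 1)"
      using init[OF e] by blast
    show "\<exists>N. \<forall>I\<ge>N. \<forall>J\<ge>N. \<forall>i\<le>I. L2_set (\<lambda>j. v I J i j - grid T u I J i j) {..J}
            \<le> 2 * (1 + T * (c + 1)) * e * sqrt (real J + 1)"
    proof (rule exI[of _ "N1 + N2 + N3 + 1"], intro allI impI)
      fix I J i assume A: "N1 + N2 + N3 + 1 \<le> I" "N1 + N2 + N3 + 1 \<le> J" "i \<le> I"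
      have IJ: "I \<ge> 1" "J \<ge> 1" using A by auto
      define E where "E = e * sqrt (real J + 1)"
      \<comment> \<open>Absolute values let the same residual serve for the positive parts of
        \<open>v - u\<close> and of \<open>u - v\<close>.\<close>
      define r where "r i j = c * \<bar>p I J i j - grid T q I J i j\<bar> + \<bar>\<rho> I J i j\<bar>" for i j
      define h where "h i j = source (real j / real J) (v I J i j) (p I J i j)" for i j
      define k where "k i j = source (real j / real J) (grid T u I J i j) (grid T q I J i j)" for i j
      have V: "disc_parabolic T (\<sigma>\<^sup>2 / 2) I J (v I J) h"
        using v[OF IJ] by (simp add: h_def[abs_def])
      have W: "disc_parabolic T (\<sigma>\<^sup>2 / 2) I J (grid T u I J) (\<lambda>i j. k i j + \<rho> I J i j)"
        using \<rho>[OF IJ] by (simp add: k_def grid_def)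
      have R: "L2_set (r i) {..J} \<le> (c + 1) * E" if "i \<le> I" for i
      proof -
        have "L2_set (r i) {..J} \<le> L2_set (\<lambda>j. c * \<bar>p I J i j - grid T q I J i j\<bar>) {..J} + L2_set (\<lambda>j. \<bar>\<rho> I J i j\<bar>) {..J}"
          unfolding r_def by (rule L2_set_triangle_ineq)
        also have "L2_set (\<lambda>j. c * \<bar>p I J i j - grid T q I J i j\<bar>) {..J} = c * L2_set (\<lambda>j. p I J i j - grid T q I J i j) {..J}"
          unfolding L2_set_right_distrib[OF c] by (simp add: L2_set_def power_mult_distrib)
        also have "\<dots> \<le> c * E"
          using N1 A that c unfolding E_def by (intro mult_left_mono) auto
        also have "L2_set (\<lambda>j. \<bar>\<rho> I J i j\<bar>) {..J} = L2_set (\<rho> I J i) {..J}"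
          by (simp add: L2_set_def)
        also have "\<dots> \<le> E" using N2 A that unfolding E_def by auto
        finally show ?thesis by (simp add: algebra_simps)
      qed
      have point: "\<bar>source (real j / real J) (grid T u I J i j) (p I J i j) - k i j\<bar> + \<bar>\<rho> I J i j\<bar> \<le> r i j"
        "grid T u I J i j \<ge> 0" "v I J i j \<ge> 0" "p I J i j \<ge> 0" "real j / real J \<in> {0..1}"
        if ij: "i \<le> I" "j \<le> J" for i j
      proof -
        note dom = grid_in_domain[OF less_imp_le[OF T] ij]
        show u0: "grid T u I J i j \<ge> 0" and p0: "p I J i j \<ge> 0" and "v I J i j \<ge> 0"
          using nonneg dom dnonneg[OF IJ ij] by (auto simp: grid_def)
        show x: "real j / real J \<in> {0..1}" by (rule dom)
        have q0: "grid T q I J i j \<ge> 0" using nonneg dom by (auto simp: grid_def)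
        have "grid T u I J i j \<le> U" using U(2)[OF dom] by (simp add: grid_def)
        then have "\<bar>K\<bar> / \<sigma>\<^sup>2 * (grid T u I J i j)\<^sup>2 \<le> c"
          using u0 unfolding c_def by (intro mult_left_mono power_mono) auto
        then have "\<bar>K\<bar> / \<sigma>\<^sup>2 * (grid T u I J i j)\<^sup>2 * \<bar>p I J i j - grid T q I J i j\<bar>
            \<le> c * \<bar>p I J i j - grid T q I J i j\<bar>"
          by (rule mult_right_mono) simp
        then show "\<bar>source (real j / real J) (grid T u I J i j) (p I J i j) - k i j\<bar> + \<bar>\<rho> I J i j\<bar> \<le> r i j"
          using source_lipschitz[OF x u0 p0 q0] unfolding k_def r_def by linarith
      qed
      have up: "L2_set (\<lambda>j. max 0 (v I J i j - grid T u I J i j)) {..J}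
          \<le> L2_set (\<lambda>j. max 0 (v I J 0 j - grid T u I J 0 j)) {..J} + T * ((c + 1) * E)"
      proof (rule disc_parabolic_positive_part[OF T IJ(1) half_sigma2_nonneg V W, where r = r])
        fix i j assume B: "i < I" "j \<le> J" "grid T u I J (Suc i) j < v I J (Suc i) j"
        have ij: "Suc i \<le> I" using B by simp
        note P = point[OF ij B(2)]
        have "h (Suc i) j \<le> source (real j / real J) (grid T u I J (Suc i) j) (p I J (Suc i) j)"
          unfolding h_def using B P by (intro source_antimono mult_right_mono) auto
        then show "h (Suc i) j - (k (Suc i) j + \<rho> I J (Suc i) j) \<le> r (Suc i) j"
          using P(1) by linarith
      qed (use R A in auto)
      have dn: "L2_set (\<lambda>j. max 0 (grid T u I J i j - v I J i j)) {..J}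
          \<le> L2_set (\<lambda>j. max 0 (grid T u I J 0 j - v I J 0 j)) {..J} + T * ((c + 1) * E)"
      proof (rule disc_parabolic_positive_part[OF T IJ(1) half_sigma2_nonneg W V, where r = r])
        fix i j assume B: "i < I" "j \<le> J" "v I J (Suc i) j < grid T u I J (Suc i) j"
        have ij: "Suc i \<le> I" using B by simp
        note P = point[OF ij B(2)]
        have "source (real j / real J) (grid T u I J (Suc i) j) (p I J (Suc i) j) \<le> h (Suc i) j"
          unfolding h_def using B P by (intro source_antimono mult_right_mono) auto
        then show "k (Suc i) j + \<rho> I J (Suc i) j - h (Suc i) j \<le> r (Suc i) j"
          using P(1) by linarith
      qed (use R A in auto)
      have i0: "L2_set (\<lambda>j. v I J 0 j - grid T u I J 0 j) {..J} \<le> E"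
        using N3 A unfolding E_def grid_def by simp
      have i1: "L2_set (\<lambda>j. max 0 (v I J 0 j - grid T u I J 0 j)) {..J} \<le> E"
        and i2: "L2_set (\<lambda>j. max 0 (grid T u I J 0 j - v I J 0 j)) {..J} \<le> E"
        by (rule order_trans[OF L2_set_abs_le i0]; simp)+
      have "L2_set (\<lambda>j. v I J i j - grid T u I J i j) {..J}
          \<le> L2_set (\<lambda>j. max 0 (v I J i j - grid T u I J i j) + max 0 (grid T u I J i j - v I J i j)) {..J}"
        by (rule L2_set_abs_le) auto
      also have "\<dots> \<le> L2_set (\<lambda>j. max 0 (v I J i j - grid T u I J i j)) {..J}
          + L2_set (\<lambda>j. max 0 (grid T u I J i j - v I J i j)) {..J}"
        by (rule L2_set_triangle_ineq)
      also have "\<dots> \<le> (E + T * ((c + 1) * E)) + (E + T * ((c + 1) * E))"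
        using order_trans[OF up add_right_mono[OF i1]] order_trans[OF dn add_right_mono[OF i2]]
        by (rule add_mono)
      finally have "L2_set (\<lambda>j. v I J i j - grid T u I J i j) {..J} \<le> (E + T * ((c + 1) * E)) + (E + T * ((c + 1) * E))" .
      then show "L2_set (\<lambda>j. v I J i j - grid T u I J i j) {..J} \<le> 2 * (1 + T * (c + 1)) * e * sqrt (real J + 1)"
        by (simp add: E_def algebra_simps)
    qed
  qed
qed

section \<open>Reduction of the equations and schemes to the common forward form\<close>

lemma parabolic_of_fwd_solution:
  assumes "fwd_solution T \<sigma> f phi m0 psi"
  shows "parabolic T (\<sigma>\<^sup>2 / 2) psi (\<lambda>t x. source x (psi t x) (phi t x))"
  using assms unfolding fwd_solution_def parabolic_def source_def by (metis mult.commute)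

lemma parabolic_of_bwd_solution:
  assumes "bwd_solution T \<sigma> f psi uT phi"
  shows "parabolic T (\<sigma>\<^sup>2 / 2) (\<lambda>t. phi (T - t)) (\<lambda>t x. source x (phi (T - t) x) (psi (T - t) x))"
proof -
  obtain pt px pxx where C: "C12_with T phi pt px pxx"
    and pde: "\<And>t x. t\<in>{0<..<T} \<Longrightarrow> x\<in>{0<..<1} \<Longrightarrow>
           pt t x + \<sigma>\<^sup>2 / 2 * pxx t x = - (1 / \<sigma>\<^sup>2) * f x (phi t x * psi t x) * phi t x"
    and bc: "\<And>t. t\<in>{0..T} \<Longrightarrow> px t 0 = 0 \<and> px t 1 = 0"
    using assms unfolding bwd_solution_def by blast
  have "- pt (T - t) x - \<sigma>\<^sup>2 / 2 * pxx (T - t) x = source x (phi (T - t) x) (psi (T - t) x)"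
    if "t \<in> {0<..<T}" "x \<in> {0<..<1}" for t x
    using pde[of "T - t" x] that unfolding source_def by simp
  then show ?thesis
    unfolding parabolic_def using C12_with_reverse[OF C] bc
    by (intro exI[of _ "\<lambda>t x. - pt (T - t) x"] exI[of _ "\<lambda>t. px (T - t)"] exI[of _ "\<lambda>t. pxx (T - t)"]) auto
qed

lemma disc_parabolic_of_psi_scheme:
  assumes "disc_psi_scheme T \<sigma> f m0 I J ph ps"
  shows "disc_parabolic T (\<sigma>\<^sup>2 / 2) I J ps (\<lambda>i j. source (real j / real J) (ps i j) (ph i j))"
  using assms unfolding disc_psi_scheme_def disc_parabolic_def source_def disc_lap_def
  by (simp add: mult.commute)

text \<open>The backward scheme evaluates Laplacian and reaction at the earlier of its two levels;
  under \<open>i \<mapsto> I - i\<close> this becomes the new level, so the reversed scheme is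
  implicit as required.\<close>

lemma disc_parabolic_of_phi_scheme:
  assumes "disc_phi_scheme T \<sigma> f uT I J ps ph"
  shows "disc_parabolic T (\<sigma>\<^sup>2 / 2) I J (\<lambda>i. ph (I - i)) (\<lambda>i j. source (real j / real J) (ph (I - i) j) (ps (I - i) j))"
  unfolding disc_parabolic_def
proof (intro allI impI)
  fix i j assume ij: "i < I" "j \<le> J"
  define l where "l = I - Suc i"
  have l: "l < I" "I - i = Suc l" using ij by (auto simp: l_def)
  have eq: "(ph (Suc l) j - ph l j) / (T / real I) + \<sigma>\<^sup>2 / 2 * disc_lap J (ph l) j / (1 / real J)\<^sup>2
      = - source (real j / real J) (ph l j) (ps l j)"
    using assms l ij unfolding disc_phi_scheme_def disc_lap_def source_def by simp
  have "(ph l j - ph (Suc l) j) / (T / real I) = - ((ph (Suc l) j - ph l j) / (T / real I))"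
    by (simp only: minus_divide_left minus_diff_eq)
  then show "(ph (I - Suc i) j - ph (I - i) j) / (T / real I)
      - \<sigma>\<^sup>2 / 2 * disc_lap J (ph (I - Suc i)) j / (1 / real J)\<^sup>2
      = source (real j / real J) (ph (I - Suc i) j) (ps (I - Suc i) j)"
    using eq unfolding l l_def[symmetric] by linarith
qed

end

subsection \<open>Passage to the limit\<close>

text \<open>The sets where \<open>g n\<close> is at least \<open>e\<close> are compact and nested;
  if none were empty, a common point would contradict pointwise convergence.\<close>

lemma Dini_decreasing:
  fixes g :: "nat \<Rightarrow> 'a::euclidean_space \<Rightarrow> real"
  assumes S: "compact S" and c: "\<And>n. continuous_on S (g n)"
    and dec: "\<And>n x. x \<in> S \<Longrightarrow> g (Suc n) x \<le> g n x"
    and lim: "\<And>x. x \<in> S \<Longrightarrow> (\<lambda>n. g n x) \<longlonglongrightarrow> 0" and e: "e > 0"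
  shows "\<exists>N. \<forall>n\<ge>N. \<forall>x\<in>S. \<bar>g n x\<bar> < e"
proof -
  have anti: "decseq (\<lambda>n. g n x)" if "x \<in> S" for x
    using dec[OF that] by (rule decseq_SucI)
  have dec': "g n x \<le> g m x" if "x \<in> S" "m \<le> n" for n m x
    using decseqD[OF anti] that by blast
  have nn: "g n x \<ge> 0" if "x \<in> S" for n x
    using decseq_ge[OF anti lim] that by blast
  have "\<exists>N. \<forall>x\<in>S. g N x < e"
  proof (rule ccontr)
    assume neg: "\<not> ?thesis"
    define F where "F n = S \<inter> g n -` {e..}" for n
    have "\<Inter>(range F) \<noteq> {}"
    proof (rule compact_nest)
      fix n
      have "closed (F n)" unfolding F_def
        by (rule continuous_closed_preimage[OF c compact_imp_closed[OF S]]) simp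
      then have "compact (S \<inter> F n)"
        by (rule compact_Int_closed[OF S])
      then show "compact (F n)" by (simp add: F_def)
      obtain x where "x \<in> S" "\<not> g n x < e" using neg by blast
      then show "F n \<noteq> {}" by (auto simp: F_def not_less)
    next
      fix m n :: nat assume mn: "m \<le> n"
      show "F n \<subseteq> F m" 
      proof
        fix x assume "x \<in> F n"
        then show "x \<in> F m" using dec'[of x m n] mn by (simp add: F_def)
      qed
    qed
    then obtain x where "x \<in> \<Inter>(range F)" by blast
    then have x: "x \<in> S" "\<And>n. e \<le> g n x" by (simp_all add: F_def)
    have "e \<le> 0" using tendsto_lowerbound[OF lim[OF x(1)]] x(2) by simp
    then show False using e by simp
  qed
  then obtain N where N: "\<forall>x\<in>S. g N x < e" ..
  have "\<bar>g n x\<bar> < e" if "n \<ge> N" "x \<in> S" for n x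
    using dec'[OF that(2,1)] nn[OF that(2), of n] N that(2) by force
  then show ?thesis by blast
qed

lemma disc_norm_le:
  assumes "\<And>i. i \<le> I \<Longrightarrow> L2_set (m i) {..J} \<le> e * sqrt (real J + 1)" and e: "e \<ge> 0"
  shows "disc_norm I J m \<le> e"
proof -
  have "1 / (real J + 1) * (\<Sum>j\<le>J. (m i j)\<^sup>2) \<le> e\<^sup>2" if "i \<le> I" for i
  proof -
    have "(\<Sum>j\<le>J. (m i j)\<^sup>2) = (L2_set (m i) {..J})\<^sup>2" by (simp add: L2_set_def sum_nonneg)
    also have "\<dots> \<le> (e * sqrt (real J + 1))\<^sup>2" using assms(1)[OF that] by (intro power_mono) auto
    also have "\<dots> = e\<^sup>2 * (real J + 1)" by (simp add: power_mult_distrib)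
    finally show ?thesis by (simp add: divide_le_eq)
  qed
  then have "(MAX i\<in>{..I}. 1 / (real J + 1) * (\<Sum>j\<le>J. (m i j)\<^sup>2)) \<le> e\<^sup>2"
    by (intro Max.boundedI) auto
  then show ?thesis unfolding disc_norm_def using e by (intro real_le_lsqrt) auto
qed

lemma disc_norm_nonneg: "disc_norm I J m \<ge> 0"
proof -
  have "0 \<le> 1 / (real J + 1) * (\<Sum>j\<le>J. (m 0 j)\<^sup>2)" by (simp add: sum_nonneg)
  also have "\<dots> \<le> (MAX i\<in>{..I}. 1 / (real J + 1) * (\<Sum>j\<le>J. (m i j)\<^sup>2))" by (rule Max_ge) auto
  finally show ?thesis unfolding disc_norm_def by simp
qed

text \<open>The error splits into the mesh error of the iterate \<open>u n\<close> and its distance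
  to \<open>w\<close>. The limit superior over the mesh is taken first, so the mesh threshold may
  depend on \<open>n\<close>, while the second part is bounded on all meshes at once.\<close>

lemma Limsup_disc_norm_tendsto_0:
  assumes T: "T > 0"
    and conv: "\<And>n. grid_null (\<lambda>I J i j. v n I J i j - grid T (u n) I J i j)"
    and unif: "\<And>e. e > 0 \<Longrightarrow> \<exists>N. \<forall>n\<ge>N. \<forall>t\<in>{0..T}. \<forall>x\<in>{0..1}. \<bar>u n t x - w t x\<bar> < e"
  shows "(\<lambda>n. Limsup (sequentially \<times>\<^sub>F sequentially)
            (\<lambda>(I, J). ereal (disc_norm I J
               (\<lambda>i j. v n I J i j - w (T * real i / real I) (real j / real J))))) \<longlonglongrightarrow> 0"
    (is "(\<lambda>n. ?L n) \<longlonglongrightarrow> 0")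
proof (rule order_tendstoI)
  fix a :: ereal assume a: "a < 0"
  \<comment> \<open>A lower bound for the limit superior needs a nontrivial filter, hence the fact
    on \<open>prod_filter_eq_bot\<close>.\<close>
  have "0 \<le> ?L n" for n
    by (rule le_Limsup) (simp_all add: prod_filter_eq_bot disc_norm_nonneg case_prod_unfold)
  then show "eventually (\<lambda>n. a < ?L n) sequentially"
    using a by (intro always_eventually allI) (rule less_le_trans)
next
  fix a :: ereal assume a: "0 < a"
  then obtain e where e: "0 < ereal e" "ereal e < a" using ereal_dense2 by blast
  then have e2: "e / 2 > 0" by simp
  obtain N where N: "\<And>n t x. n \<ge> N \<Longrightarrow> t \<in> {0..T} \<Longrightarrow> x \<in> {0..1} \<Longrightarrow> \<bar>u n t x - w t x\<bar> < e / 2"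
    using unif[OF e2] by blast
  have "?L n \<le> ereal e" if n: "n \<ge> N" for n
  proof (rule Limsup_bounded)
    obtain M where M: "\<forall>I\<ge>M. \<forall>J\<ge>M. \<forall>i\<le>I. L2_set (\<lambda>j. v n I J i j - grid T (u n) I J i j) {..J} \<le> e / 2 * sqrt (real J + 1)"
      using grid_nullD[OF conv e2] by blast
    have "disc_norm I J (\<lambda>i j. v n I J i j - w (T * real i / real I) (real j / real J)) \<le> e"
      if IJ: "I \<ge> M" "J \<ge> M" for I J
    proof (rule disc_norm_le)
      fix i assume i: "i \<le> I"
      have "L2_set (\<lambda>j. grid T (u n) I J i j - grid T w I J i j) {..J} \<le> L2_set (\<lambda>j. e / 2) {..J}"
      proof (rule L2_set_abs_le)
        fix j assume "j \<in> {..J}"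
        then have "\<bar>grid T (u n) I J i j - grid T w I J i j\<bar> < e / 2"
          unfolding grid_def using N[OF n] grid_in_domain[of T i I j J] i T by simp
        then show "\<bar>grid T (u n) I J i j - grid T w I J i j\<bar> \<le> \<bar>e / 2\<bar>" using e2 by simp
      qed
      also have "\<dots> = e / 2 * sqrt (real J + 1)"
        using e2 by (simp add: L2_set_constant add.commute)
      finally have "L2_set (\<lambda>j. (v n I J i j - grid T (u n) I J i j) + (grid T (u n) I J i j - grid T w I J i j)) {..J}
          \<le> e / 2 * sqrt (real J + 1) + e / 2 * sqrt (real J + 1)"
        using M IJ i by (intro order_trans[OF L2_set_triangle_ineq] add_mono) auto
      then show "L2_set (\<lambda>j. v n I J i j - w (T * real i / real I) (real j / real J)) {..J} \<le> e * sqrt (real J + 1)"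
        by (simp add: grid_def)
    qed (use e in simp)
    then show "eventually (\<lambda>p. (case p of (I, J) \<Rightarrow> ereal (disc_norm I J
        (\<lambda>i j. v n I J i j - w (T * real i / real I) (real j / real J)))) \<le> ereal e) (sequentially \<times>\<^sub>F sequentially)"
      unfolding eventually_prod_sequentially by auto
  qed
  then show "eventually (\<lambda>n. ?L n < a) sequentially"
    unfolding eventually_sequentially using e(2) by (meson le_less_trans)
qed

theorem theorem4:
  fixes T \<sigma> K :: real
    and uT m0 :: "real \<Rightarrow> real"
    and f :: "real \<Rightarrow> real \<Rightarrow> real"
    and phic psic :: "nat \<Rightarrow> real \<Rightarrow> real \<Rightarrow> real"
    and phi psi :: "real \<Rightarrow> real \<Rightarrow> real"
    and phih psih :: "nat \<Rightarrow> nat \<Rightarrow> nat \<Rightarrow> nat \<Rightarrow> nat \<Rightarrow> real"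
  assumes T_pos: "T > 0" and sigma_pos: "\<sigma> > 0"
    and uT_bdd: "\<exists>B. \<forall>x\<in>{0..1}. \<bar>uT x\<bar> \<le> B"
    and m0_bdd: "\<exists>B. \<forall>x\<in>{0..1}. \<bar>m0 x\<bar> \<le> B"
    and m0_nonneg: "\<forall>x\<in>{0..1}. m0 x \<ge> 0"
    and f_cont: "continuous_on ({0..1} \<times> UNIV) (\<lambda>(x, \<xi>). f x \<xi>)"
    and f_noninc: "\<forall>x\<in>{0..1}. \<forall>\<xi>1 \<xi>2. \<xi>1 \<le> \<xi>2 \<longrightarrow> f x \<xi>2 \<le> f x \<xi>1"
    and f_bdd: "\<exists>B. \<forall>x\<in>{0..1}. \<forall>\<xi>. \<bar>f x \<xi>\<bar> \<le> B"
    and f_nonpos: "\<forall>x\<in>{0..1}. \<forall>\<xi>. f x \<xi> \<le> 0"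
    and f_lip: "\<forall>x\<in>{0..1}. \<forall>\<xi>1 \<ge> 0. \<forall>\<xi>2 \<ge> 0. \<bar>f x \<xi>2 - f x \<xi>1\<bar> \<le> K * \<bar>\<xi>2 - \<xi>1\<bar>"
    and psic0: "\<forall>t\<in>{0..T}. \<forall>x\<in>{0..1}. psic 0 t x = 0"
    and phic_sol: "\<forall>n. bwd_solution T \<sigma> f (psic n) uT (phic n)"
    and psic_sol: "\<forall>n. fwd_solution T \<sigma> f (phic n) m0 (psic (Suc n))"
    and phi_lim: "\<forall>t\<in>{0..T}. \<forall>x\<in>{0..1}. (\<lambda>n. phic n t x) \<longlonglongrightarrow> phi t x"
    and psi_lim: "\<forall>t\<in>{0..T}. \<forall>x\<in>{0..1}. (\<lambda>n. psic n t x) \<longlonglongrightarrow> psi t x"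
    and phi_C12: "C12 T phi" and psi_C12: "C12 T psi"
    and disc_init: "\<forall>I J. I \<ge> 1 \<longrightarrow> J \<ge> 1 \<longrightarrow> (\<forall>i\<le>I. \<forall>j\<le>J. psih I J 0 i j = 0)"
    and disc_phi: "\<forall>I J n. I \<ge> 1 \<longrightarrow> J \<ge> 1 \<longrightarrow>
                     disc_phi_scheme T \<sigma> f uT I J (psih I J n) (phih I J n)"
    and disc_psi: "\<forall>I J n. I \<ge> 1 \<longrightarrow> J \<ge> 1 \<longrightarrow>
                     disc_psi_scheme T \<sigma> f m0 I J (phih I J n) (psih I J (Suc n))"
  shows "(\<lambda>n. Limsup (sequentially \<times>\<^sub>F sequentially)
            (\<lambda>(I, J). ereal (disc_norm I J
               (\<lambda>i j. phih I J n i j - phi (T * real i / real I) (real j / real J)))))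
           \<longlonglongrightarrow> 0 \<and>
         (\<lambda>n. Limsup (sequentially \<times>\<^sub>F sequentially)
            (\<lambda>(I, J). ereal (disc_norm I J
               (\<lambda>i j. psih I J (Suc n) i j - psi (T * real i / real I) (real j / real J)))))
           \<longlonglongrightarrow> 0"
proof -
  let ?Q = "{0..T} \<times> {0..1::real}"
  obtain B where B: "\<forall>x\<in>{0..1}. \<forall>\<xi>. \<bar>f x \<xi>\<bar> \<le> B" using f_bdd by blast
  interpret coupling \<sigma> K B f
    by unfold_locales (use sigma_pos f_cont f_noninc B f_nonpos f_lip in auto)
  obtain Bu where Bu: "\<forall>x\<in>{0..1}. \<bar>uT x\<bar> \<le> Bu" using uT_bdd by blast
  obtain Bm where Bm: "\<forall>x\<in>{0..1}. \<bar>m0 x\<bar> \<le> Bm" using m0_bdd by blast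
  define m where "m = exp (- Bu / \<sigma>\<^sup>2)"
  have m: "m > 0" by (simp add: m_def)
  have m_le: "m \<le> exp (uT x / \<sigma>\<^sup>2)" if "x \<in> {0..1}" for x
  proof -
    have "- Bu \<le> uT x" using Bu[rule_format, OF that] by linarith
    then have "- Bu / \<sigma>\<^sup>2 \<le> uT x / \<sigma>\<^sup>2" by (rule divide_right_mono) simp
    then show ?thesis by (simp add: m_def)
  qed
  \<comment> \<open>A single positive lower bound for every \<open>phi\<close> iterate, continuous
    or discrete, on every mesh: \<open>m\<close> bounds the terminal datum from below and the
    exponential is the decay of the barrier over the whole time interval.\<close>
  define lo where "lo = m * exp (- (B / \<sigma>\<^sup>2) * T)"
  have lo: "lo > 0" using m by (simp add: lo_def)

  \<comment> \<open>Bounds and continuity of the continuous iterates\<close>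
  have phic_par: "parabolic T (\<sigma>\<^sup>2 / 2) (\<lambda>t. phic n (T - t)) (\<lambda>t x. source x (phic n (T - t) x) (psic n (T - t) x))" for n
    using phic_sol by (blast intro: parabolic_of_bwd_solution)
  have psic_par: "parabolic T (\<sigma>\<^sup>2 / 2) (psic (Suc n)) (\<lambda>t x. source x (psic (Suc n) t x) (phic n t x))" for n
    using psic_sol by (blast intro: parabolic_of_fwd_solution)
  have phic_T: "phic n T x = exp (uT x / \<sigma>\<^sup>2)" if "x \<in> {0..1}" for n x
    using phic_sol that unfolding bwd_solution_def by blast
  have psic_0: "psic (Suc n) 0 x = m0 x / phic n 0 x" if "x \<in> {0..1}" for n x
    using psic_sol that unfolding fwd_solution_def by blast
  have phic_lo: "phic n t x \<ge> lo" if "t \<in> {0..T}" "x \<in> {0..1}" for n t x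
    using solution_lower_bound[OF T_pos phic_par[of n] less_imp_le[OF m], where t = "T - t" and x = x] that m_le phic_T
    by (simp add: lo_def)
  have phic_nonneg: "phic n t x \<ge> 0" if "t \<in> {0..T}" "x \<in> {0..1}" for n t x
    using phic_lo[OF that, of n] lo by simp
  have psic_nonneg: "psic n t x \<ge> 0" if "t \<in> {0..T}" "x \<in> {0..1}" for n t x
  proof (cases n)
    case 0
    then show ?thesis using psic0 that by simp
  next
    case (Suc k)
    have "psic (Suc k) t x \<ge> 0"
      by (rule solution_nonneg[OF T_pos psic_par _ that])
         (use psic_0 m0_nonneg phic_nonneg T_pos in auto)
    then show ?thesis using Suc by simp
  qed
  have phic_cont: "continuous_on ?Q (\<lambda>(t,x). phic n t x)" for n
    using phic_sol unfolding bwd_solution_def C12_with_def by blast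
  \<comment> \<open>The starting iterate is not given by any equation and is known to vanish only on
    the rectangle, so it is treated apart.\<close>
  have psic_cont: "continuous_on ?Q (\<lambda>(t,x). psic n t x)" for n
  proof (cases n)
    case 0
    have "continuous_on ?Q (\<lambda>(t,x). psic 0 t x) \<longleftrightarrow> continuous_on ?Q (\<lambda>_. 0::real)"
      by (rule continuous_on_cong) (use psic0 in auto)
    then show ?thesis using 0 by simp
  next
    case (Suc k)
    then show ?thesis using parabolic_continuous[OF psic_par] by simp
  qed

  \<comment> \<open>Monotonicity of the continuous iterates\<close>
  have phic_step: "phic (Suc n) t x \<le> phic n t x"
    if mono: "\<And>t x. t \<in> {0..T} \<Longrightarrow> x \<in> {0..1} \<Longrightarrow> psic n t x \<le> psic (Suc n) t x"
      and tx: "t \<in> {0..T}" "x \<in> {0..1}" for n t x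
  proof -
    \<comment> \<open>A larger \<open>psi\<close> makes absorption stronger: where the new
      \<open>phi\<close> exceeded the old one, both factors of the product would be larger, so
      \<open>source_antimono\<close> orders the sources as the comparison requires.\<close>
    have "phic (Suc n) (T - (T - t)) x \<le> phic n (T - (T - t)) x"
    proof (rule parabolic_comparison[OF T_pos half_sigma2_nonneg phic_par phic_par])
      fix t x :: real
      assume A: "t \<in> {0<..<T}" "x \<in> {0<..<1}" "phic n (T - t) x < phic (Suc n) (T - t) x"
      then show "source x (phic (Suc n) (T - t) x) (psic (Suc n) (T - t) x) \<le> source x (phic n (T - t) x) (psic n (T - t) x)"
        using phic_nonneg psic_nonneg mono by (intro source_antimono mult_mono) auto
    qed (use tx phic_T in auto)
    then show ?thesis by simp
  qed
  have psic_step: "psic (Suc n) t x \<le> psic (Suc (Suc n)) t x"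
    if mono: "\<And>t x. t \<in> {0..T} \<Longrightarrow> x \<in> {0..1} \<Longrightarrow> phic (Suc n) t x \<le> phic n t x"
      and tx: "t \<in> {0..T}" "x \<in> {0..1}" for n t x
  \<comment> \<open>A smaller \<open>phi\<close> acts twice in the same direction: it weakens
    absorption and raises the initial value \<open>m0 / phi\<close>, the latter thanks to the lower
    bound \<open>lo\<close>.\<close>
  proof (rule parabolic_comparison[OF T_pos half_sigma2_nonneg psic_par psic_par _ _ tx])
    fix t x :: real
    assume A: "t \<in> {0<..<T}" "x \<in> {0<..<1}" "psic (Suc (Suc n)) t x < psic (Suc n) t x"
    then show "source x (psic (Suc n) t x) (phic n t x) \<le> source x (psic (Suc (Suc n)) t x) (phic (Suc n) t x)"
      using phic_nonneg psic_nonneg mono by (intro source_antimono mult_mono) auto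
  next
    fix x :: real assume x: "x \<in> {0..1}"
    have "0 < phic (Suc n) 0 x" using phic_lo[of 0 x "Suc n"] lo x T_pos by simp
    then show "psic (Suc n) 0 x \<le> psic (Suc (Suc n)) 0 x"
      unfolding psic_0[OF x] using mono[of 0 x] x m0_nonneg T_pos by (intro divide_left_mono) auto
  qed
  have mono: "\<forall>t\<in>{0..T}. \<forall>x\<in>{0..1}. psic n t x \<le> psic (Suc n) t x \<and> phic (Suc n) t x \<le> phic n t x" for n
  proof (induction n)
    case 0
    have "psic 0 t x \<le> psic (Suc 0) t x" if "t \<in> {0..T}" "x \<in> {0..1}" for t x
      using psic0 psic_nonneg[OF that, of "Suc 0"] that by simp
    then show ?case using phic_step[of 0] by blast
  next
    case (Suc n)
    have "psic (Suc n) t x \<le> psic (Suc (Suc n)) t x" if "t \<in> {0..T}" "x \<in> {0..1}" for t x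
      using psic_step Suc that by blast
    then show ?case using phic_step[of "Suc n"] by blast
  qed

  \<comment> \<open>Uniform convergence of the continuous iterates\<close>
  have phi_unif: "\<exists>N. \<forall>n\<ge>N. \<forall>t\<in>{0..T}. \<forall>x\<in>{0..1}. \<bar>phic n t x - phi t x\<bar> < e" if e: "e > 0" for e
  proof -
    have c: "continuous_on ?Q (\<lambda>(t,x). phi t x)"
      using phi_C12 unfolding C12_def C12_with_def by blast
    have "\<exists>N. \<forall>n\<ge>N. \<forall>p\<in>?Q. \<bar>(\<lambda>(t,x). phic n t x - phi t x) p\<bar> < e"
    proof (rule Dini_decreasing[OF _ _ _ _ e])
      show "compact ?Q" by (simp add: compact_Times)
      show "continuous_on ?Q (\<lambda>(t,x). phic n t x - phi t x)" for n
        using continuous_on_diff[OF phic_cont c] by (simp add: case_prod_unfold)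
      fix p assume p: "p \<in> ?Q"
      show "(\<lambda>(t,x). phic (Suc n) t x - phi t x) p \<le> (\<lambda>(t,x). phic n t x - phi t x) p" for n
        using mono p by auto
      show "(\<lambda>n. (\<lambda>(t,x). phic n t x - phi t x) p) \<longlonglongrightarrow> 0"
        using phi_lim p by (auto intro: LIM_zero)
    qed
    then show ?thesis by auto
  qed
  have psi_unif: "\<exists>N. \<forall>n\<ge>N. \<forall>t\<in>{0..T}. \<forall>x\<in>{0..1}. \<bar>psic (Suc n) t x - psi t x\<bar> < e" if e: "e > 0" for e
  proof -
    have c: "continuous_on ?Q (\<lambda>(t,x). psi t x)"
      using psi_C12 unfolding C12_def C12_with_def by blast
    \<comment> \<open>The \<open>psi\<close> iterates increase, so the decreasing sequence is the
      difference in this order; the sign and the shift of the index are undone afterwards.\<close>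
    have "\<exists>N. \<forall>n\<ge>N. \<forall>p\<in>?Q. \<bar>(\<lambda>(t,x). psi t x - psic n t x) p\<bar> < e"
    proof (rule Dini_decreasing[OF _ _ _ _ e])
      show "compact ?Q" by (simp add: compact_Times)
      show "continuous_on ?Q (\<lambda>(t,x). psi t x - psic n t x)" for n
        using continuous_on_diff[OF c psic_cont] by (simp add: case_prod_unfold)
      fix p assume p: "p \<in> ?Q"
      show "(\<lambda>(t,x). psi t x - psic (Suc n) t x) p \<le> (\<lambda>(t,x). psi t x - psic n t x) p" for n
        using mono p by auto
      have "(\<lambda>n. psi (fst p) (snd p) - psic n (fst p) (snd p)) \<longlonglongrightarrow> psi (fst p) (snd p) - psi (fst p) (snd p)"
        using psi_lim p by (intro tendsto_diff tendsto_const) auto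
      then show "(\<lambda>n. (\<lambda>(t,x). psi t x - psic n t x) p) \<longlonglongrightarrow> 0"
        by (simp add: case_prod_unfold)
    qed
    then obtain N where "\<forall>n\<ge>N. \<forall>t\<in>{0..T}. \<forall>x\<in>{0..1}. \<bar>psi t x - psic n t x\<bar> < e" by auto
    then show ?thesis by (metis abs_minus_commute le_Suc_eq)
  qed

  \<comment> \<open>Bounds for the discrete iterates\<close>
  have phih_par: "disc_parabolic T (\<sigma>\<^sup>2 / 2) I J (\<lambda>i. phih I J n (I - i))
      (\<lambda>i j. source (real j / real J) (phih I J n (I - i) j) (psih I J n (I - i) j))"
    if "I \<ge> 1" "J \<ge> 1" for I J n
    using disc_phi that by (blast intro: disc_parabolic_of_phi_scheme)
  have psih_par: "disc_parabolic T (\<sigma>\<^sup>2 / 2) I J (psih I J (Suc n))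
      (\<lambda>i j. source (real j / real J) (psih I J (Suc n) i j) (phih I J n i j))"
    if "I \<ge> 1" "J \<ge> 1" for I J n
    using disc_psi that by (blast intro: disc_parabolic_of_psi_scheme)
  have phih_T: "phih I J n I j = exp (uT (real j / real J) / \<sigma>\<^sup>2)" if "I \<ge> 1" "J \<ge> 1" "j \<le> J" for I J n j
    using disc_phi that unfolding disc_phi_scheme_def by blast
  have psih_0: "psih I J (Suc n) 0 j = m0 (real j / real J) / phih I J n 0 j" if "I \<ge> 1" "J \<ge> 1" "j \<le> J" for I J n j
    using disc_psi that unfolding disc_psi_scheme_def by blast
  have phih_lo: "phih I J n i j \<ge> lo" if "I \<ge> 1" "J \<ge> 1" "i \<le> I" "j \<le> J" for I J n i j
  proof -
    have "phih I J n (I - (I - i)) j \<ge> m * exp (- (B / \<sigma>\<^sup>2) * T)"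
    proof (rule disc_solution_lower_bound[OF T_pos that(1) phih_par[OF that(1,2)] less_imp_le[OF m]])
      fix k assume "k \<le> J"
      then show "m \<le> phih I J n (I - 0) k"
        using phih_T[OF that(1,2)] m_le[OF unit_grid] by simp
    qed (use that in auto)
    then show ?thesis using that by (simp add: lo_def)
  qed
  have phih_nonneg: "phih I J n i j \<ge> 0" if "I \<ge> 1" "J \<ge> 1" "i \<le> I" "j \<le> J" for I J n i j
    using phih_lo[OF that, of n] lo by simp
  have psih_nonneg: "psih I J n i j \<ge> 0" if "I \<ge> 1" "J \<ge> 1" "i \<le> I" "j \<le> J" for I J n i j
  proof (cases n)
    case 0
    then show ?thesis using disc_init that by simp
  next
    case (Suc k)
    have "psih I J (Suc k) i j \<ge> 0"
    proof (rule disc_solution_nonneg[OF T_pos that(1) psih_par[OF that(1,2)] _ that(3,4)])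
      fix l assume l: "l \<le> J"
      show "0 \<le> psih I J (Suc k) 0 l"
        using psih_0[OF that(1,2) l] m0_nonneg unit_grid[OF l] phih_nonneg[OF that(1,2) _ l] by auto
    qed
    then show ?thesis using Suc by simp
  qed

  \<comment> \<open>Mesh convergence of each iterate\<close>
  have phi_conv: "grid_null (\<lambda>I J i j. phih I J n i j - grid T (phic n) I J i j)"
    if psi: "grid_null (\<lambda>I J i j. psih I J n i j - grid T (psic n) I J i j)" for n
  proof -
    have "grid_null (\<lambda>I J i j. phih I J n (I - i) j - grid T (\<lambda>t. phic n (T - t)) I J i j)"
    proof (rule grid_convergence[OF T_pos phic_par])
      show "continuous_on ?Q (\<lambda>(t,x). psic n (T - t) x)"
      proof -
        have "continuous_on ?Q (\<lambda>p. (\<lambda>(t,x). psic n t x) (T - fst p, snd p))"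
          by (rule continuous_on_compose2[OF psic_cont]) (auto intro!: continuous_intros)
        then show ?thesis by (simp add: case_prod_unfold)
      qed
      show "grid_null (\<lambda>I J i j. psih I J n (I - i) j - grid T (\<lambda>t. psic n (T - t)) I J i j)"
        by (rule grid_null_cong[OF grid_null_reverse[OF psi]]) (simp add: grid_reverse)
      fix e :: real assume e: "e > 0"
      \<comment> \<open>Both terminal data sample \<open>uT\<close> at the same nodes, so the
        reversed problem starts without error.\<close>
      have "L2_set (\<lambda>j. phih I J n (I - 0) j - phic n (T - 0) (real j / real J)) {..J} = 0"
        if "I \<ge> 1" "J \<ge> 1" for I J
        using phih_T[OF that] phic_T[OF unit_grid] by (intro L2_set_0') auto
      then show "\<exists>N. \<forall>I\<ge>N. \<forall>J\<ge>N. L2_set (\<lambda>j. phih I J n (I - 0) j - phic n (T - 0) (real j / real J)) {..J} \<le> e * sqrt (real J + 1)"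
        using e by (intro exI[of _ 1]) simp
    qed (use phic_nonneg psic_nonneg phih_nonneg psih_nonneg phih_par in auto)
    from grid_null_reverse[OF this] show ?thesis
      by (rule grid_null_cong) (simp add: grid_reverse)
  qed
  have psi_conv: "grid_null (\<lambda>I J i j. psih I J (Suc n) i j - grid T (psic (Suc n)) I J i j)"
    if phi: "grid_null (\<lambda>I J i j. phih I J n i j - grid T (phic n) I J i j)" for n
  proof (rule grid_convergence[OF T_pos psic_par phic_cont])
    fix e :: real assume e: "e > 0"
    \<comment> \<open>Lipschitz constant of \<open>p \<mapsto> m0 / p\<close> on values at least
      \<open>lo\<close>, from \<open>\<bar>m0 / p - m0 / q\<bar> = \<bar>m0\<bar> * \<bar>p -
      q\<bar> / (p * q)\<close>; the added 1 keeps it positive, as it is divided by.\<close>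
    define c where "c = (\<bar>Bm\<bar> + 1) / lo\<^sup>2"
    have c: "c > 0" using lo by (simp add: c_def)
    then have "e / c > 0" using e by simp
    then obtain N where N: "\<forall>I\<ge>N. \<forall>J\<ge>N. \<forall>i\<le>I.
        L2_set (\<lambda>j. phih I J n i j - grid T (phic n) I J i j) {..J} \<le> e / c * sqrt (real J + 1)"
      using grid_nullD[OF phi] by blast
    \<comment> \<open>The threshold \<open>Suc N\<close> rather than \<open>N\<close> excludes
      \<open>I = 0\<close> and \<open>J = 0\<close>, for which no scheme is assumed.\<close>
    have "L2_set (\<lambda>j. psih I J (Suc n) 0 j - psic (Suc n) 0 (real j / real J)) {..J} \<le> e * sqrt (real J + 1)"
      if IJ: "Suc N \<le> I" "Suc N \<le> J" for I J
    proof -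
      have IJ1: "I \<ge> 1" "J \<ge> 1" using IJ by auto
      have "L2_set (\<lambda>j. psih I J (Suc n) 0 j - psic (Suc n) 0 (real j / real J)) {..J}
          \<le> L2_set (\<lambda>j. c * (phih I J n 0 j - grid T (phic n) I J 0 j)) {..J}"
      proof (rule L2_set_abs_le)
        fix j assume "j \<in> {..J}"
        then have j: "j \<le> J" by simp
        define x where "x = real j / real J"
        have x: "x \<in> {0..1}" unfolding x_def by (rule unit_grid[OF j])
        define p where "p = phih I J n 0 j"
        define q where "q = phic n 0 x"
        have p: "p \<ge> lo" unfolding p_def using phih_lo IJ1 j by blast
        have q: "q \<ge> lo" unfolding q_def using phic_lo x T_pos by simp
        have "lo\<^sup>2 \<le> p * q" unfolding power2_eq_square using p q lo by (intro mult_mono) auto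
        have "m0 x / p - m0 x / q = m0 x * (q - p) / (p * q)"
          using p q lo by (simp add: field_simps)
        then have "\<bar>m0 x / p - m0 x / q\<bar> = \<bar>m0 x\<bar> * \<bar>p - q\<bar> / (p * q)"
          using p q lo by (simp add: abs_mult abs_minus_commute)
        also have "\<dots> \<le> (\<bar>Bm\<bar> + 1) * \<bar>p - q\<bar> / lo\<^sup>2"
        proof (rule frac_le)
          have "\<bar>m0 x\<bar> \<le> \<bar>Bm\<bar> + 1" using Bm x by force
          then show "\<bar>m0 x\<bar> * \<bar>p - q\<bar> \<le> (\<bar>Bm\<bar> + 1) * \<bar>p - q\<bar>" by (rule mult_right_mono) simp
        qed (use lo \<open>lo\<^sup>2 \<le> p * q\<close> in auto)
        also have "\<dots> = \<bar>c * (p - q)\<bar>" using c by (simp add: abs_mult c_def)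
        finally show "\<bar>psih I J (Suc n) 0 j - psic (Suc n) 0 (real j / real J)\<bar>
            \<le> \<bar>c * (phih I J n 0 j - grid T (phic n) I J 0 j)\<bar>"
          using psih_0[OF IJ1 j] psic_0[OF x] by (simp add: p_def q_def x_def grid_def)
      qed
      also have "\<dots> = c * L2_set (\<lambda>j. phih I J n 0 j - grid T (phic n) I J 0 j) {..J}"
        using c by (simp add: L2_set_right_distrib)
      also have "\<dots> \<le> c * (e / c * sqrt (real J + 1))"
        using N IJ c by (intro mult_left_mono) auto
      finally show ?thesis using c by simp
    qed
    then show "\<exists>N. \<forall>I\<ge>N. \<forall>J\<ge>N.
        L2_set (\<lambda>j. psih I J (Suc n) 0 j - psic (Suc n) 0 (real j / real J)) {..J} \<le> e * sqrt (real J + 1)"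
      by blast
  qed (use phi phic_nonneg psic_nonneg phih_nonneg psih_nonneg psih_par in auto)
  have psi_grid: "grid_null (\<lambda>I J i j. psih I J n i j - grid T (psic n) I J i j)" for n
  proof (induction n)
    case 0
    have "grid_null (\<lambda>I J i j. 0)" by (auto simp: grid_null_def L2_set_0')
    then show ?case
    proof (rule grid_null_cong)
      fix I J i j :: nat assume A: "I \<ge> 1" "J \<ge> 1" "i \<le> I" "j \<le> J"
      show "psih I J 0 i j - grid T (psic 0) I J i j = 0"
        using disc_init psic0 A grid_in_domain[OF less_imp_le[OF T_pos] A(3,4)] by (simp add: grid_def)
    qed
  next
    case (Suc n)
    then show ?case by (intro psi_conv phi_conv)
  qed
  show ?thesis
    using Limsup_disc_norm_tendsto_0[OF T_pos phi_conv[OF psi_grid] phi_unif]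
      Limsup_disc_norm_tendsto_0[OF T_pos psi_grid[of "Suc _"] psi_unif] by blast
qed

end
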